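(* Let $\mathcal{A}$ be a locally noetherian Grothendieck category and let $\gamma$ be a left exact preradical functor on $\mathcal{A}$. Then $\gamma$ preserves injective objects if and only if $\mathcal{T}_\gamma$ is stable.
   Context: A preradical functor on $\mathcal{A}$ is a subobject $\gamma$ of the identity functor: $\gamma(M)$ is a subobject of $M$ for each object $M$, and for $f:M\to N$ the morphism $\gamma(f)$ is the restriction of $f$ to $\gamma(M)$. The pretorsion class of $\gamma$ is $\mathcal{T}_\gamma=\{T\in\mathcal{A}\mid\gamma(T)=T\}$. A pretorsion class $\mathcal{X}$ is stable if the injective envelope in $\mathcal{A}$ of every object of $\mathcal{X}$ is again an object of $\mathcal{X}$. *)

theory Defs
  imports "HOL-Algebra.Group"
begin

unbundle cardinal_syntax

section \<open>Categories\<close>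

text \<open>
  Composition is written in the usual order: \<open>g \<cdot>\<^bsub>C\<^esub> f\<close> is \<open>f\<close> followed by \<open>g\<close>. All
  operations are only meaningful on the objects and arrows of the category.
\<close>

record ('o, 'm) cat =
  Obj :: "'o set"
  Arr :: "'m set"
  Dom :: "'m \<Rightarrow> 'o"
  Cod :: "'m \<Rightarrow> 'o"
  Ident :: "'o \<Rightarrow> 'm"
  Comp :: "'m \<Rightarrow> 'm \<Rightarrow> 'm"  (infixl \<open>\<cdot>\<index>\<close> 70)

definition Hom :: "('o, 'm, 'z) cat_scheme \<Rightarrow> 'o \<Rightarrow> 'o \<Rightarrow> 'm set" where
  "Hom C X Y = {f \<in> Arr C. Dom C f = X \<and> Cod C f = Y}"

locale category =
  fixes C :: "('o, 'm, 'z) cat_scheme" (structure)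
  assumes Dom_Obj: "f \<in> Arr C \<Longrightarrow> Dom C f \<in> Obj C"
    and Cod_Obj: "f \<in> Arr C \<Longrightarrow> Cod C f \<in> Obj C"
    and Ident_Hom: "X \<in> Obj C \<Longrightarrow> Ident C X \<in> Hom C X X"
    and Comp_Hom: "f \<in> Hom C X Y \<Longrightarrow> g \<in> Hom C Y Z \<Longrightarrow> g \<cdot> f \<in> Hom C X Z"
    and Comp_Ident: "f \<in> Hom C X Y \<Longrightarrow> f \<cdot> Ident C X = f"
    and Ident_Comp: "f \<in> Hom C X Y \<Longrightarrow> Ident C Y \<cdot> f = f"
    and Comp_assoc: "f \<in> Hom C W X \<Longrightarrow> g \<in> Hom C X Y \<Longrightarrow> h \<in> Hom C Y Z \<Longrightarrow>
      (h \<cdot> g) \<cdot> f = h \<cdot> (g \<cdot> f)"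

definition is_mono :: "('o, 'm, 'z) cat_scheme \<Rightarrow> 'm \<Rightarrow> bool" where
  "is_mono C f \<longleftrightarrow> f \<in> Arr C \<and>
    (\<forall>X \<in> Obj C. \<forall>g \<in> Hom C X (Dom C f). \<forall>h \<in> Hom C X (Dom C f).
      f \<cdot>\<^bsub>C\<^esub> g = f \<cdot>\<^bsub>C\<^esub> h \<longrightarrow> g = h)"

definition is_epi :: "('o, 'm, 'z) cat_scheme \<Rightarrow> 'm \<Rightarrow> bool" where
  "is_epi C f \<longleftrightarrow> f \<in> Arr C \<and>
    (\<forall>Y \<in> Obj C. \<forall>g \<in> Hom C (Cod C f) Y. \<forall>h \<in> Hom C (Cod C f) Y.
      g \<cdot>\<^bsub>C\<^esub> f = h \<cdot>\<^bsub>C\<^esub> f \<longrightarrow> g = h)"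

definition is_iso :: "('o, 'm, 'z) cat_scheme \<Rightarrow> 'm \<Rightarrow> bool" where
  "is_iso C f \<longleftrightarrow> f \<in> Arr C \<and>
    (\<exists>g \<in> Hom C (Cod C f) (Dom C f).
      g \<cdot>\<^bsub>C\<^esub> f = Ident C (Dom C f) \<and> f \<cdot>\<^bsub>C\<^esub> g = Ident C (Cod C f))"

definition zero_object :: "('o, 'm, 'z) cat_scheme \<Rightarrow> 'o \<Rightarrow> bool" where
  "zero_object C Z \<longleftrightarrow> Z \<in> Obj C \<and>
    (\<forall>X \<in> Obj C. (\<exists>!f. f \<in> Hom C Z X) \<and> (\<exists>!f. f \<in> Hom C X Z))"

text \<open>
  A subobject of \<open>X\<close> is given by a monomorphism with codomain \<open>X\<close>; two of them represent the same
  subobject if each is below the other in the following preorder.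
\<close>

definition sub_le :: "('o, 'm, 'z) cat_scheme \<Rightarrow> 'm \<Rightarrow> 'm \<Rightarrow> bool" where
  "sub_le C m n \<longleftrightarrow> (\<exists>h \<in> Hom C (Dom C m) (Dom C n). n \<cdot>\<^bsub>C\<^esub> h = m)"

definition is_pullback :: "('o, 'm, 'z) cat_scheme \<Rightarrow> 'm \<Rightarrow> 'm \<Rightarrow> 'm \<Rightarrow> 'm \<Rightarrow> bool" where
  "is_pullback C f g p q \<longleftrightarrow>
    f \<in> Arr C \<and> g \<in> Arr C \<and> Cod C f = Cod C g \<and>
    p \<in> Hom C (Dom C p) (Dom C f) \<and> q \<in> Hom C (Dom C p) (Dom C g) \<and>
    f \<cdot>\<^bsub>C\<^esub> p = g \<cdot>\<^bsub>C\<^esub> q \<and>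
    (\<forall>T \<in> Obj C. \<forall>a \<in> Hom C T (Dom C f). \<forall>b \<in> Hom C T (Dom C g).
      f \<cdot>\<^bsub>C\<^esub> a = g \<cdot>\<^bsub>C\<^esub> b \<longrightarrow>
      (\<exists>!h. h \<in> Hom C T (Dom C p) \<and> p \<cdot>\<^bsub>C\<^esub> h = a \<and> q \<cdot>\<^bsub>C\<^esub> h = b))"

definition is_coproduct ::
  "('o, 'm, 'z) cat_scheme \<Rightarrow> 'i set \<Rightarrow> ('i \<Rightarrow> 'o) \<Rightarrow> 'o \<Rightarrow> ('i \<Rightarrow> 'm) \<Rightarrow> bool" where
  "is_coproduct C I X S \<iota> \<longleftrightarrow> S \<in> Obj C \<and> (\<forall>i \<in> I. \<iota> i \<in> Hom C (X i) S) \<and>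
    (\<forall>T \<in> Obj C. \<forall>a. (\<forall>i \<in> I. a i \<in> Hom C (X i) T) \<longrightarrow>
      (\<exists>!h. h \<in> Hom C S T \<and> (\<forall>i \<in> I. h \<cdot>\<^bsub>C\<^esub> \<iota> i = a i)))"

section \<open>Abelian categories\<close>

text \<open>\<open>Add\<close> and \<open>Zero\<close> are the addition and the zero morphisms of the abelian groups \<open>Hom C X Y\<close>.\<close>

record ('o, 'm) abcat = "('o, 'm) cat" +
  Add :: "'m \<Rightarrow> 'm \<Rightarrow> 'm"
  Zero :: "'o \<Rightarrow> 'o \<Rightarrow> 'm"

locale preadditive_category = category C
  for C :: "('o, 'm, 'z) abcat_scheme" (structure) +
  assumes Hom_comm_group: "X \<in> Obj C \<Longrightarrow> Y \<in> Obj C \<Longrightarrow>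
      comm_group \<lparr>carrier = Hom C X Y, mult = Add C, one = Zero C X Y\<rparr>"
    and Comp_Add: "f \<in> Hom C X Y \<Longrightarrow> f' \<in> Hom C X Y \<Longrightarrow> g \<in> Hom C Y Z \<Longrightarrow>
      g \<cdot> Add C f f' = Add C (g \<cdot> f) (g \<cdot> f')"
    and Add_Comp: "f \<in> Hom C X Y \<Longrightarrow> g \<in> Hom C Y Z \<Longrightarrow> g' \<in> Hom C Y Z \<Longrightarrow>
      Add C g g' \<cdot> f = Add C (g \<cdot> f) (g' \<cdot> f)"

definition is_biproduct ::
  "('o, 'm, 'z) abcat_scheme \<Rightarrow> 'o \<Rightarrow> 'o \<Rightarrow> 'o \<Rightarrow> 'm \<Rightarrow> 'm \<Rightarrow> 'm \<Rightarrow> 'm \<Rightarrow> bool" where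
  "is_biproduct C X Y S i j p q \<longleftrightarrow>
    S \<in> Obj C \<and> i \<in> Hom C X S \<and> j \<in> Hom C Y S \<and> p \<in> Hom C S X \<and> q \<in> Hom C S Y \<and>
    p \<cdot>\<^bsub>C\<^esub> i = Ident C X \<and> q \<cdot>\<^bsub>C\<^esub> j = Ident C Y \<and>
    Add C (i \<cdot>\<^bsub>C\<^esub> p) (j \<cdot>\<^bsub>C\<^esub> q) = Ident C S"

definition is_kernel :: "('o, 'm, 'z) abcat_scheme \<Rightarrow> 'm \<Rightarrow> 'm \<Rightarrow> bool" where
  "is_kernel C k f \<longleftrightarrow>
    k \<in> Arr C \<and> f \<in> Arr C \<and> Cod C k = Dom C f \<and>
    f \<cdot>\<^bsub>C\<^esub> k = Zero C (Dom C k) (Cod C f) \<and>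
    (\<forall>T \<in> Obj C. \<forall>g \<in> Hom C T (Dom C f). f \<cdot>\<^bsub>C\<^esub> g = Zero C T (Cod C f) \<longrightarrow>
      (\<exists>!h. h \<in> Hom C T (Dom C k) \<and> k \<cdot>\<^bsub>C\<^esub> h = g))"

definition is_cokernel :: "('o, 'm, 'z) abcat_scheme \<Rightarrow> 'm \<Rightarrow> 'm \<Rightarrow> bool" where
  "is_cokernel C c f \<longleftrightarrow>
    c \<in> Arr C \<and> f \<in> Arr C \<and> Dom C c = Cod C f \<and>
    c \<cdot>\<^bsub>C\<^esub> f = Zero C (Dom C f) (Cod C c) \<and>
    (\<forall>T \<in> Obj C. \<forall>g \<in> Hom C (Cod C f) T. g \<cdot>\<^bsub>C\<^esub> f = Zero C (Dom C f) T \<longrightarrow>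
      (\<exists>!h. h \<in> Hom C (Cod C c) T \<and> h \<cdot>\<^bsub>C\<^esub> c = g))"

text \<open>Exactness of \<open>0 \<rightarrow> X \<rightarrow> Y \<rightarrow> Z \<rightarrow> 0\<close>, with \<open>f : X \<rightarrow> Y\<close> and \<open>g : Y \<rightarrow> Z\<close>.\<close>

definition short_exact :: "('o, 'm, 'z) abcat_scheme \<Rightarrow> 'm \<Rightarrow> 'm \<Rightarrow> bool" where
  "short_exact C f g \<longleftrightarrow> is_kernel C f g \<and> is_cokernel C g f"

locale abelian_category = preadditive_category C
  for C :: "('o, 'm, 'z) abcat_scheme" (structure) +
  assumes ex_zero_object: "\<exists>Z. zero_object C Z"
    and ex_biproduct: "X \<in> Obj C \<Longrightarrow> Y \<in> Obj C \<Longrightarrow> \<exists>S i j p q. is_biproduct C X Y S i j p q"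
    and ex_kernel: "f \<in> Arr C \<Longrightarrow> \<exists>k. is_kernel C k f"
    and ex_cokernel: "f \<in> Arr C \<Longrightarrow> \<exists>c. is_cokernel C c f"
    and mono_normal: "is_mono C f \<Longrightarrow> \<exists>g. is_kernel C f g"
    and epi_conormal: "is_epi C f \<Longrightarrow> \<exists>g. is_cokernel C f g"

section \<open>Direct limits\<close>

definition directed_on :: "'i set \<Rightarrow> ('i \<times> 'i) set \<Rightarrow> bool" where
  "directed_on I r \<longleftrightarrow> preorder_on I r \<and> I \<noteq> {} \<and>
    (\<forall>i \<in> I. \<forall>j \<in> I. \<exists>k \<in> I. (i, k) \<in> r \<and> (j, k) \<in> r)"

definition direct_system ::
  "('o, 'm, 'z) cat_scheme \<Rightarrow> 'i set \<Rightarrow> ('i \<times> 'i) set \<Rightarrow> ('i \<Rightarrow> 'o) \<Rightarrow> ('i \<Rightarrow> 'i \<Rightarrow> 'm) \<Rightarrow> bool" where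
  "direct_system C I r X \<phi> \<longleftrightarrow> directed_on I r \<and> (\<forall>i \<in> I. X i \<in> Obj C) \<and>
    (\<forall>i j. (i, j) \<in> r \<longrightarrow> \<phi> i j \<in> Hom C (X i) (X j)) \<and>
    (\<forall>i \<in> I. \<phi> i i = Ident C (X i)) \<and>
    (\<forall>i j k. (i, j) \<in> r \<longrightarrow> (j, k) \<in> r \<longrightarrow> \<phi> j k \<cdot>\<^bsub>C\<^esub> \<phi> i j = \<phi> i k)"

definition cocone ::
  "('o, 'm, 'z) cat_scheme \<Rightarrow> 'i set \<Rightarrow> ('i \<times> 'i) set \<Rightarrow> ('i \<Rightarrow> 'o) \<Rightarrow> ('i \<Rightarrow> 'i \<Rightarrow> 'm) \<Rightarrow>
    'o \<Rightarrow> ('i \<Rightarrow> 'm) \<Rightarrow> bool" where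
  "cocone C I r X \<phi> T a \<longleftrightarrow> T \<in> Obj C \<and> (\<forall>i \<in> I. a i \<in> Hom C (X i) T) \<and>
    (\<forall>i j. (i, j) \<in> r \<longrightarrow> a j \<cdot>\<^bsub>C\<^esub> \<phi> i j = a i)"

definition is_direct_limit ::
  "('o, 'm, 'z) cat_scheme \<Rightarrow> 'i set \<Rightarrow> ('i \<times> 'i) set \<Rightarrow> ('i \<Rightarrow> 'o) \<Rightarrow> ('i \<Rightarrow> 'i \<Rightarrow> 'm) \<Rightarrow>
    'o \<Rightarrow> ('i \<Rightarrow> 'm) \<Rightarrow> bool" where
  "is_direct_limit C I r X \<phi> L u \<longleftrightarrow> direct_system C I r X \<phi> \<and> cocone C I r X \<phi> L u \<and>
    (\<forall>T a. cocone C I r X \<phi> T a \<longrightarrow>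
      (\<exists>!h. h \<in> Hom C L T \<and> (\<forall>i \<in> I. h \<cdot>\<^bsub>C\<^esub> u i = a i)))"

definition system_morphism ::
  "('o, 'm, 'z) cat_scheme \<Rightarrow> 'i set \<Rightarrow> ('i \<times> 'i) set \<Rightarrow> ('i \<Rightarrow> 'o) \<Rightarrow> ('i \<Rightarrow> 'i \<Rightarrow> 'm) \<Rightarrow>
    ('i \<Rightarrow> 'o) \<Rightarrow> ('i \<Rightarrow> 'i \<Rightarrow> 'm) \<Rightarrow> ('i \<Rightarrow> 'm) \<Rightarrow> bool" where
  "system_morphism C I r X \<phi> Y \<psi> f \<longleftrightarrow> (\<forall>i \<in> I. f i \<in> Hom C (X i) (Y i)) \<and>
    (\<forall>i j. (i, j) \<in> r \<longrightarrow> \<psi> i j \<cdot>\<^bsub>C\<^esub> f i = f j \<cdot>\<^bsub>C\<^esub> \<phi> i j)"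

section \<open>Locally noetherian Grothendieck categories\<close>

definition separating :: "('o, 'm, 'z) cat_scheme \<Rightarrow> 'o set \<Rightarrow> bool" where
  "separating C \<G> \<longleftrightarrow> \<G> \<subseteq> Obj C \<and>
    (\<forall>X \<in> Obj C. \<forall>Y \<in> Obj C. \<forall>f \<in> Hom C X Y. \<forall>g \<in> Hom C X Y.
      f \<noteq> g \<longrightarrow> (\<exists>G \<in> \<G>. \<exists>h \<in> Hom C G X. f \<cdot>\<^bsub>C\<^esub> h \<noteq> g \<cdot>\<^bsub>C\<^esub> h))"

definition generator :: "('o, 'm, 'z) cat_scheme \<Rightarrow> 'o \<Rightarrow> bool" where
  "generator C G \<longleftrightarrow> separating C {G}"

text \<open>
  The objects of \<open>C\<close> form a set of HOL, so a notion of smallness is needed: by Freyd's argument only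
  preorders have coproducts indexed by arbitrary sets. A set is called small if its cardinality is
  less than \<open>\<kappa>\<close>. If \<open>\<kappa>\<close> is strongly inaccessible, this is smallness with respect to a
  Grothendieck universe, and the definition below is the usual one of a (locally small)
  Grothendieck category. Only regularity and uncountability of \<open>\<kappa>\<close> are required, because HOL does
  not prove the existence of inaccessible cardinals; thus the countable abelian groups, with
  \<open>\<kappa>\<close> the first uncountable cardinal, are an instance too.

  For the same reason local smallness is imposed on the morphisms out of one generator \<open>G\<close>. If \<open>\<kappa>\<close>
  is a strong limit then all \<open>Hom C X Y\<close> are small: \<open>X\<close> is a quotient of a coproduct of a small
  family of copies of \<open>G\<close>, so \<open>Hom C X Y\<close> embeds into a small power of \<open>Hom C G Y\<close>.

  As \<open>\<kappa>\<close> has type \<open>'u rel\<close>, each small set is in bijection with a set of type \<open>'u set\<close>, so that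
  it suffices to consider index sets of this type.
\<close>

locale grothendieck_category = abelian_category C
  for \<kappa> :: "'u rel" and C :: "('o, 'm, 'z) abcat_scheme" (structure) +
  assumes Card_order: "Card_order \<kappa>"
    and regular: "regularCard \<kappa>"
    and uncountable: "natLeq <o \<kappa>"
    and ex_generator: "\<exists>G. generator C G \<and> (\<forall>X \<in> Obj C. |Hom C G X| <o \<kappa>)"
    and ex_coproduct: "\<And>(I :: 'u set) X. |I| <o \<kappa> \<Longrightarrow> (\<And>i. i \<in> I \<Longrightarrow> X i \<in> Obj C) \<Longrightarrow>
      \<exists>S \<iota>. is_coproduct C I X S \<iota>"
    and direct_limit_exact: "\<And>(I :: 'u set) r X \<phi> Y \<psi> Z \<chi> f g L u M v N w f' g'.
      |I| <o \<kappa> \<Longrightarrow>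
      is_direct_limit C I r X \<phi> L u \<Longrightarrow>
      is_direct_limit C I r Y \<psi> M v \<Longrightarrow>
      is_direct_limit C I r Z \<chi> N w \<Longrightarrow>
      system_morphism C I r X \<phi> Y \<psi> f \<Longrightarrow>
      system_morphism C I r Y \<psi> Z \<chi> g \<Longrightarrow>
      (\<And>i. i \<in> I \<Longrightarrow> short_exact C (f i) (g i)) \<Longrightarrow>
      f' \<in> Hom C L M \<Longrightarrow> (\<And>i. i \<in> I \<Longrightarrow> f' \<cdot> u i = v i \<cdot> f i) \<Longrightarrow>
      g' \<in> Hom C M N \<Longrightarrow> (\<And>i. i \<in> I \<Longrightarrow> g' \<cdot> v i = w i \<cdot> g i) \<Longrightarrow>
      short_exact C f' g'"

definition noetherian_object :: "('o, 'm, 'z) cat_scheme \<Rightarrow> 'o \<Rightarrow> bool" where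
  "noetherian_object C X \<longleftrightarrow> X \<in> Obj C \<and>
    (\<forall>m :: nat \<Rightarrow> 'm.
      (\<forall>n. is_mono C (m n) \<and> Cod C (m n) = X) \<and> (\<forall>n. sub_le C (m n) (m (Suc n))) \<longrightarrow>
      (\<exists>N. \<forall>n \<ge> N. sub_le C (m n) (m N)))"

locale locally_noetherian_grothendieck_category = grothendieck_category \<kappa> C
  for \<kappa> :: "'u rel" and C :: "('o, 'm, 'z) abcat_scheme" (structure) +
  assumes ex_noetherian_generators:
    "\<exists>\<G>. |\<G>| <o \<kappa> \<and> separating C \<G> \<and> (\<forall>G \<in> \<G>. noetherian_object C G)"

section \<open>Injective objects and injective envelopes\<close>

definition injective_object :: "('o, 'm, 'z) cat_scheme \<Rightarrow> 'o \<Rightarrow> bool" where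
  "injective_object C E \<longleftrightarrow> E \<in> Obj C \<and>
    (\<forall>m f. is_mono C m \<and> f \<in> Hom C (Dom C m) E \<longrightarrow>
      (\<exists>g \<in> Hom C (Cod C m) E. g \<cdot>\<^bsub>C\<^esub> m = f))"

text \<open>The intersection of two subobjects is their pullback.\<close>

definition essential_mono :: "('o, 'm, 'z) cat_scheme \<Rightarrow> 'm \<Rightarrow> bool" where
  "essential_mono C m \<longleftrightarrow> is_mono C m \<and>
    (\<forall>n p q. is_mono C n \<and> Cod C n = Cod C m \<and> is_pullback C m n p q \<and> zero_object C (Dom C p) \<longrightarrow>
      zero_object C (Dom C n))"

definition injective_envelope :: "('o, 'm, 'z) cat_scheme \<Rightarrow> 'o \<Rightarrow> 'o \<Rightarrow> 'm \<Rightarrow> bool" where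
  "injective_envelope C X E e \<longleftrightarrow> e \<in> Hom C X E \<and> essential_mono C e \<and> injective_object C E"

text \<open>
  An injective envelope is unique up to isomorphism only, so the definition refers to each of them.
\<close>

definition is_stable :: "('o, 'm, 'z) cat_scheme \<Rightarrow> 'o set \<Rightarrow> bool" where
  "is_stable C \<X> \<longleftrightarrow> (\<forall>X \<in> \<X>. \<forall>E e. injective_envelope C X E e \<longrightarrow> E \<in> \<X>)"

section \<open>Functors and preradicals\<close>

record ('o, 'm, 'p, 'n) ftor =
  OMap :: "'o \<Rightarrow> 'p"
  AMap :: "'m \<Rightarrow> 'n"

definition is_functor ::
  "('o, 'm, 'y) cat_scheme \<Rightarrow> ('p, 'n, 'z) cat_scheme \<Rightarrow> ('o, 'm, 'p, 'n, 'w) ftor_scheme \<Rightarrow> bool" where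
  "is_functor C D F \<longleftrightarrow>
    (\<forall>X \<in> Obj C. OMap F X \<in> Obj D \<and> AMap F (Ident C X) = Ident D (OMap F X)) \<and>
    (\<forall>f \<in> Arr C. AMap F f \<in> Hom D (OMap F (Dom C f)) (OMap F (Cod C f))) \<and>
    (\<forall>f \<in> Arr C. \<forall>g \<in> Arr C. Cod C f = Dom C g \<longrightarrow>
      AMap F (g \<cdot>\<^bsub>C\<^esub> f) = AMap F g \<cdot>\<^bsub>D\<^esub> AMap F f)"

definition additive_functor ::
  "('o, 'm, 'y) abcat_scheme \<Rightarrow> ('p, 'n, 'z) abcat_scheme \<Rightarrow> ('o, 'm, 'p, 'n, 'w) ftor_scheme \<Rightarrow> bool" where
  "additive_functor C D F \<longleftrightarrow> is_functor C D F \<and>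
    (\<forall>X \<in> Obj C. \<forall>Y \<in> Obj C. \<forall>f \<in> Hom C X Y. \<forall>g \<in> Hom C X Y.
      AMap F (Add C f g) = Add D (AMap F f) (AMap F g))"

definition left_exact ::
  "('o, 'm, 'y) abcat_scheme \<Rightarrow> ('p, 'n, 'z) abcat_scheme \<Rightarrow> ('o, 'm, 'p, 'n, 'w) ftor_scheme \<Rightarrow> bool" where
  "left_exact C D F \<longleftrightarrow> additive_functor C D F \<and>
    (\<forall>k f. is_kernel C k f \<longrightarrow> is_kernel D (AMap F k) (AMap F f))"

definition preserves_injectives ::
  "('o, 'm, 'y) cat_scheme \<Rightarrow> ('p, 'n, 'z) cat_scheme \<Rightarrow> ('o, 'm, 'p, 'n, 'w) ftor_scheme \<Rightarrow> bool" where
  "preserves_injectives C D F \<longleftrightarrow>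
    (\<forall>E. injective_object C E \<longrightarrow> injective_object D (OMap F E))"

text \<open>
  The subobject \<open>\<gamma>(X)\<close> of \<open>X\<close> is represented by the monomorphism \<open>Incl \<gamma> X : \<gamma>(X) \<rightarrow> X\<close>. Naturality
  says that \<open>\<gamma>(f)\<close> is the restriction of \<open>f\<close>, and \<open>\<gamma>(X) = X\<close> as subobjects of \<open>X\<close> means that
  \<open>Incl \<gamma> X\<close> is an isomorphism.
\<close>

record ('o, 'm) preradical = "('o, 'm, 'o, 'm) ftor" +
  Incl :: "'o \<Rightarrow> 'm"

definition is_preradical ::
  "('o, 'm, 'z) cat_scheme \<Rightarrow> ('o, 'm, 'w) preradical_scheme \<Rightarrow> bool" where
  "is_preradical C \<gamma> \<longleftrightarrow> is_functor C C \<gamma> \<and>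
    (\<forall>X \<in> Obj C. Incl \<gamma> X \<in> Hom C (OMap \<gamma> X) X \<and> is_mono C (Incl \<gamma> X)) \<and>
    (\<forall>f \<in> Arr C. Incl \<gamma> (Cod C f) \<cdot>\<^bsub>C\<^esub> AMap \<gamma> f = f \<cdot>\<^bsub>C\<^esub> Incl \<gamma> (Dom C f))"

definition pretorsion_class ::
  "('o, 'm, 'z) cat_scheme \<Rightarrow> ('o, 'm, 'w) preradical_scheme \<Rightarrow> 'o set" where
  "pretorsion_class C \<gamma> = {T \<in> Obj C. is_iso C (Incl \<gamma> T)}"

end

theory Submission
  imports Defs
begin

text \<open>
  If \<open>\<gamma>\<close> preserves injectives and \<open>X \<in> \<T>\<^sub>\<gamma>\<close> has injective envelope \<open>E\<close>, then \<open>\<gamma>(E)\<close> is a direct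
  summand of \<open>E\<close> containing \<open>X\<close>; its complement meets \<open>X\<close> trivially, hence is zero. Conversely, let
  \<open>\<T>\<^sub>\<gamma>\<close> be stable and \<open>E\<close> injective. Left exactness gives \<open>\<gamma>(E) \<in> \<T>\<^sub>\<gamma>\<close>. An injective envelope \<open>M\<close> of
  \<open>\<gamma>(E)\<close> can be found inside \<open>E\<close>; it lies in \<open>\<T>\<^sub>\<gamma>\<close>, so \<open>M \<subseteq> \<gamma>(E)\<close> and \<open>\<gamma>(E) = M\<close> is injective.

  To find \<open>M\<close>, take a maximal essential extension of \<open>\<gamma>(E)\<close> in \<open>E\<close>, and a subobject \<open>N\<close> of \<open>E\<close> maximal
  with \<open>N \<inter> M = 0\<close>. Then \<open>M \<rightarrow> E/N\<close> is essential, so the inclusion of \<open>M\<close> extends to a monomorphism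
  \<open>E/N \<rightarrow> E\<close>, whose image is \<open>M\<close> by maximality; thus \<open>M\<close> is a retract of \<open>E\<close>.
\<close>

section \<open>Kernels and cokernels\<close>

lemma (in category) HomD:
  assumes "f \<in> Hom C X Y"
  shows "f \<in> Arr C" "Dom C f = X" "Cod C f = Y" "X \<in> Obj C" "Y \<in> Obj C"
  using assms Dom_Obj Cod_Obj unfolding Hom_def by auto

lemma (in category) mono_cancel:
  assumes "is_mono C m" "m \<in> Hom C X Y" "g \<in> Hom C T X" "h \<in> Hom C T X" "m \<cdot> g = m \<cdot> h"
  shows "g = h"
  using assms HomD[OF assms(2)] HomD[OF assms(3)] unfolding is_mono_def by auto

lemma (in category) epi_cancel:
  assumes "is_epi C e" "e \<in> Hom C X Y" "g \<in> Hom C Y T" "h \<in> Hom C Y T" "g \<cdot> e = h \<cdot> e"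
  shows "g = h"
  using assms HomD[OF assms(2)] HomD[OF assms(3)] unfolding is_epi_def by auto

lemma (in category) mono_comp:
  assumes m: "is_mono C m" "m \<in> Hom C X Y" and n: "is_mono C n" "n \<in> Hom C Y Z"
  shows "is_mono C (n \<cdot> m)"
proof -
  have nm: "n \<cdot> m \<in> Hom C X Z" using m(2) n(2) by (rule Comp_Hom)
  have "g = h" if g: "g \<in> Hom C T X" and h: "h \<in> Hom C T X" and eq: "(n \<cdot> m) \<cdot> g = (n \<cdot> m) \<cdot> h" for T g h
  proof (rule mono_cancel[OF m g h], rule mono_cancel[OF n])
    show "m \<cdot> g \<in> Hom C T Y" "m \<cdot> h \<in> Hom C T Y" using m(2) g h by (auto intro: Comp_Hom)
    show "n \<cdot> (m \<cdot> g) = n \<cdot> (m \<cdot> h)" using eq Comp_assoc[OF g m(2) n(2)] Comp_assoc[OF h m(2) n(2)] by simp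
  qed
  then show ?thesis using HomD[OF nm] unfolding is_mono_def by auto
qed

lemma (in category) epi_comp:
  assumes d: "is_epi C d" "d \<in> Hom C X Y" and e: "is_epi C e" "e \<in> Hom C Y Z"
  shows "is_epi C (e \<cdot> d)"
proof -
  have ed: "e \<cdot> d \<in> Hom C X Z" using d(2) e(2) by (rule Comp_Hom)
  have "g = h" if g: "g \<in> Hom C Z T" and h: "h \<in> Hom C Z T" and eq: "g \<cdot> (e \<cdot> d) = h \<cdot> (e \<cdot> d)" for T g h
  proof (rule epi_cancel[OF e g h], rule epi_cancel[OF d])
    show "g \<cdot> e \<in> Hom C Y T" "h \<cdot> e \<in> Hom C Y T" using e(2) g h by (auto intro: Comp_Hom)
    show "(g \<cdot> e) \<cdot> d = (h \<cdot> e) \<cdot> d" using eq Comp_assoc[OF d(2) e(2) g] Comp_assoc[OF d(2) e(2) h] by simp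
  qed
  then show ?thesis using HomD[OF ed] unfolding is_epi_def by auto
qed

lemma (in category) mono_right_factor:
  assumes "is_mono C (n \<cdot> m)" "m \<in> Hom C X Y" "n \<in> Hom C Y Z"
  shows "is_mono C m"
proof -
  have nm: "n \<cdot> m \<in> Hom C X Z" using assms by (auto intro: Comp_Hom)
  have "g = h" if g: "g \<in> Hom C T X" and h: "h \<in> Hom C T X" and eq: "m \<cdot> g = m \<cdot> h" for T g h
    by (rule mono_cancel[OF assms(1) nm g h])
      (simp add: Comp_assoc[OF g assms(2,3)] Comp_assoc[OF h assms(2,3)] eq)
  then show ?thesis using HomD[OF assms(2)] unfolding is_mono_def by auto
qed

lemma (in category) sub_leE:
  assumes "sub_le C m n" "m \<in> Hom C X E" "n \<in> Hom C Y E"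
  obtains h where "h \<in> Hom C X Y" "n \<cdot> h = m"
  using assms HomD(2)[OF assms(2)] HomD(2)[OF assms(3)] unfolding sub_le_def by auto

lemma (in category) sub_leI:
  assumes "n \<in> Hom C Y E" "h \<in> Hom C X Y" "n \<cdot> h = m"
  shows "sub_le C m n"
  using assms HomD[OF assms(1)] HomD[OF assms(2)] HomD[OF Comp_Hom[OF assms(2,1)]]
  unfolding sub_le_def by auto

lemma (in category) sub_le_refl: "m \<in> Hom C X E \<Longrightarrow> sub_le C m m"
  by (rule sub_leI[of m X E "Ident C X"]) (auto dest: HomD intro: Ident_Hom Comp_Ident)

lemma (in category) sub_le_trans:
  assumes "sub_le C l m" "sub_le C m n" "l \<in> Hom C X E" "m \<in> Hom C Y E" "n \<in> Hom C Z E"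
  shows "sub_le C l n"
proof -
  obtain h where h: "h \<in> Hom C X Y" "m \<cdot> h = l" using sub_leE[OF assms(1,3,4)] .
  obtain k where k: "k \<in> Hom C Y Z" "n \<cdot> k = m" using sub_leE[OF assms(2,4,5)] .
  show ?thesis
    by (rule sub_leI[OF assms(5) Comp_Hom[OF h(1) k(1)]])
      (use h k Comp_assoc[OF h(1) k(1) assms(5)] in simp)
qed

lemma (in category) injective_extension:
  assumes "injective_object C E" "is_mono C m" "m \<in> Hom C X Y" "f \<in> Hom C X E"
  obtains g where "g \<in> Hom C Y E" "g \<cdot> m = f"
  using assms HomD[OF assms(3)] unfolding injective_object_def by blast

text \<open>An extension problem into \<open>A\<close> is moved to \<open>E\<close> by
  \<open>i\<close>, solved there, and brought back by \<open>r\<close>.\<close>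

lemma (in category) injective_retract:
  assumes E: "injective_object C E" and i: "i \<in> Hom C A E" and r: "r \<in> Hom C E A"
    and ri: "r \<cdot> i = Ident C A"
  shows "injective_object C A"
  unfolding injective_object_def
proof (intro conjI allI impI)
  show "A \<in> Obj C" using HomD[OF i] by simp
  fix m f assume "is_mono C m \<and> f \<in> Hom C (Dom C m) A"
  then have m: "is_mono C m" and f: "f \<in> Hom C (Dom C m) A" by auto
  have mh: "m \<in> Hom C (Dom C m) (Cod C m)" using m by (auto simp: is_mono_def Hom_def)
  obtain g where g: "g \<in> Hom C (Cod C m) E" "g \<cdot> m = i \<cdot> f"
    using injective_extension[OF E m mh Comp_Hom[OF f i]] .
  have "(r \<cdot> g) \<cdot> m = f"
    using Comp_assoc[OF mh g(1) r] Comp_assoc[OF f i r] g(2) ri Ident_Comp[OF f] by simp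
  then show "\<exists>g\<in>Hom C (Cod C m) A. g \<cdot> m = f" using Comp_Hom[OF g(1) r] by blast
qed

section \<open>Zero morphisms, kernels and cokernels in a preadditive category\<close>

context preadditive_category
begin

lemma zero_Hom:
  assumes "X \<in> Obj C" "Y \<in> Obj C"
  shows "Zero C X Y \<in> Hom C X Y"
  using comm_group.axioms(2)[OF Hom_comm_group[OF assms]] group.is_monoid monoid.one_closed by fastforce

text \<open>Cancellation in the group of arrows. Composites with zero arrows are idempotent for
  addition by distributivity, so they vanish.\<close>

lemma Add_idem_zero:
  assumes f: "f \<in> Hom C X Y" and "Add C f f = f"
  shows "f = Zero C X Y"
proof -
  interpret comm_group "\<lparr>carrier = Hom C X Y, mult = Add C, one = Zero C X Y\<rparr>"
    using Hom_comm_group HomD[OF f] by simp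
  show ?thesis using assms l_cancel_one[of f f] by simp
qed

lemma Add_zero_zero:
  assumes "X \<in> Obj C" "Y \<in> Obj C"
  shows "Add C (Zero C X Y) (Zero C X Y) = Zero C X Y"
proof -
  interpret comm_group "\<lparr>carrier = Hom C X Y, mult = Add C, one = Zero C X Y\<rparr>"
    using Hom_comm_group assms by simp
  show ?thesis using l_one[OF one_closed] by simp
qed

lemma comp_zero:
  assumes g: "g \<in> Hom C Y Z" and X: "X \<in> Obj C"
  shows "g \<cdot> Zero C X Y = Zero C X Z"
proof -
  have z: "Zero C X Y \<in> Hom C X Y" using HomD[OF g] X by (simp add: zero_Hom)
  show ?thesis
    by (rule Add_idem_zero[OF Comp_Hom[OF z g]])
      (use Comp_Add[OF z z g] Add_zero_zero[OF X HomD(4)[OF g]] in simp)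
qed

lemma zero_comp:
  assumes f: "f \<in> Hom C X Y" and Z: "Z \<in> Obj C"
  shows "Zero C Y Z \<cdot> f = Zero C X Z"
proof -
  have z: "Zero C Y Z \<in> Hom C Y Z" using HomD[OF f] Z by (simp add: zero_Hom)
  show ?thesis
    by (rule Add_idem_zero[OF Comp_Hom[OF f z]])
      (use Add_Comp[OF f z z] Add_zero_zero[OF HomD(5)[OF f] Z] in simp)
qed

lemma mono_zero_cancel:
  assumes "is_mono C m" "m \<in> Hom C X Y" "g \<in> Hom C T X" "m \<cdot> g = Zero C T Y"
  shows "g = Zero C T X"
  using assms HomD[OF assms(3)]
  by (intro mono_cancel[OF assms(1-3)]) (auto simp: zero_Hom comp_zero)

text \<open>Two arrows identified by \<open>f\<close> have a difference that \<open>f\<close> kills;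
  the group structure supplies the difference.\<close>

lemma mono_if_zero_cancel:
  assumes f: "f \<in> Hom C X Y"
    and zero: "\<And>T t. t \<in> Hom C T X \<Longrightarrow> f \<cdot> t = Zero C T Y \<Longrightarrow> t = Zero C T X"
  shows "is_mono C f"
proof -
  have "g = h" if g: "g \<in> Hom C T X" and h: "h \<in> Hom C T X" and eq: "f \<cdot> g = f \<cdot> h" for T g h
  proof -
    let ?A = "\<lparr>carrier = Hom C T X, mult = Add C, one = Zero C T X\<rparr>"
    interpret comm_group ?A using Hom_comm_group HomD[OF g] by simp
    define k where "k = inv\<^bsub>?A\<^esub> h"
    have k: "k \<in> Hom C T X" using inv_closed[of h] h by (simp add: k_def)
    have hk: "Add C h k = Zero C T X" using r_inv[of h] h by (simp add: k_def)
    have gk: "Add C g k \<in> Hom C T X" using m_closed[of g k] g k by simp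
    have "f \<cdot> Add C g k = f \<cdot> Add C h k" using Comp_Add[OF g k f] Comp_Add[OF h k f] eq by simp
    also have "\<dots> = Zero C T Y" using hk comp_zero[OF f HomD(4)[OF g]] by simp
    finally have "Add C g k = Zero C T X" using zero gk by blast
    then show ?thesis using hk right_cancel[of k g h] g h k by simp
  qed
  then show ?thesis using HomD[OF f] unfolding is_mono_def by auto
qed

lemma is_kernelD:
  assumes "is_kernel C k f" "f \<in> Hom C X Y"
  shows "k \<in> Hom C (Dom C k) X" "f \<cdot> k = Zero C (Dom C k) Y"
  using assms HomD[OF assms(2)] unfolding is_kernel_def by (auto simp: Hom_def)

lemma kernel_factor:
  assumes "is_kernel C k f" "f \<in> Hom C X Y" "g \<in> Hom C T X" "f \<cdot> g = Zero C T Y"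
  obtains h where "h \<in> Hom C T (Dom C k)" "k \<cdot> h = g"
  using assms HomD[OF assms(2)] HomD[OF assms(3)] unfolding is_kernel_def by blast

lemma kernel_mono:
  assumes ker: "is_kernel C k f"
  shows "is_mono C k"
proof -
  have f: "f \<in> Hom C (Dom C f) (Cod C f)" using ker by (auto simp: is_kernel_def Hom_def)
  note k = is_kernelD[OF ker f]
  have "g = h" if g: "g \<in> Hom C T (Dom C k)" and h: "h \<in> Hom C T (Dom C k)" and eq: "k \<cdot> g = k \<cdot> h"
    for T g h
  proof -
    have "f \<cdot> (k \<cdot> g) = Zero C T (Cod C f)"
      using Comp_assoc[OF g k(1) f] k(2) zero_comp[OF g] HomD[OF f] by simp
    moreover have "k \<cdot> g \<in> Hom C T (Dom C f)" using g k(1) by (rule Comp_Hom)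
    moreover have "T \<in> Obj C" using HomD[OF g] by simp
    ultimately have "\<exists>!l. l \<in> Hom C T (Dom C k) \<and> k \<cdot> l = k \<cdot> g"
      using ker unfolding is_kernel_def by blast
    then show ?thesis using g h eq by metis
  qed
  then show ?thesis using HomD[OF k(1)] unfolding is_mono_def by auto
qed

lemma is_cokernelD:
  assumes "is_cokernel C c f" "f \<in> Hom C X Y"
  shows "c \<in> Hom C Y (Cod C c)" "c \<cdot> f = Zero C X (Cod C c)"
  using assms HomD[OF assms(2)] unfolding is_cokernel_def by (auto simp: Hom_def)

lemma cokernel_factor:
  assumes "is_cokernel C c f" "f \<in> Hom C X Y" "g \<in> Hom C Y T" "g \<cdot> f = Zero C X T"
  obtains h where "h \<in> Hom C (Cod C c) T" "h \<cdot> c = g"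
  using assms HomD[OF assms(2)] HomD[OF assms(3)] unfolding is_cokernel_def by blast

lemma cokernel_epi:
  assumes coker: "is_cokernel C c f"
  shows "is_epi C c"
proof -
  have f: "f \<in> Hom C (Dom C f) (Cod C f)" using coker by (auto simp: is_cokernel_def Hom_def)
  note c = is_cokernelD[OF coker f]
  have "g = h" if g: "g \<in> Hom C (Cod C c) T" and h: "h \<in> Hom C (Cod C c) T" and eq: "g \<cdot> c = h \<cdot> c"
    for T g h
  proof -
    have "(g \<cdot> c) \<cdot> f = Zero C (Dom C f) T"
      using Comp_assoc[OF f c(1) g] c(2) comp_zero[OF g] HomD[OF f] by simp
    moreover have "g \<cdot> c \<in> Hom C (Cod C f) T" using c(1) g by (rule Comp_Hom)
    moreover have "T \<in> Obj C" using HomD[OF g] by simp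
    ultimately have "\<exists>!l. l \<in> Hom C (Cod C c) T \<and> l \<cdot> c = g \<cdot> c"
      using coker unfolding is_cokernel_def by blast
    then show ?thesis using g h eq by metis
  qed
  then show ?thesis using HomD[OF c(1)] unfolding is_epi_def by auto
qed

text \<open>Every arrow into or out of \<open>X\<close> is its own composite with
  \<open>Ident C X\<close>, so it vanishes once the identity does.\<close>

lemma zero_object_iff_Ident:
  assumes "X \<in> Obj C"
  shows "zero_object C X \<longleftrightarrow> Ident C X = Zero C X X"
proof
  assume "zero_object C X"
  then show "Ident C X = Zero C X X"
    using Ident_Hom zero_Hom assms unfolding zero_object_def by blast
next
  assume eq: "Ident C X = Zero C X X"
  have 1: "f = Zero C X Y" if "f \<in> Hom C X Y" for f Y
    using Comp_Ident[OF that] comp_zero[OF that assms] eq by simp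
  have 2: "f = Zero C Y X" if "f \<in> Hom C Y X" for f Y
    using Ident_Comp[OF that] zero_comp[OF that assms] eq by simp
  show "zero_object C X"
    unfolding zero_object_def using 1 2 assms zero_Hom by blast
qed

lemma zero_object_HomD:
  assumes "zero_object C Z"
  shows "f \<in> Hom C Z X \<Longrightarrow> f = Zero C Z X" "f \<in> Hom C X Z \<Longrightarrow> f = Zero C X Z"
proof -
  have Z: "Z \<in> Obj C" using assms by (simp add: zero_object_def)
  show "f = Zero C Z X" if f: "f \<in> Hom C Z X"
    using assms f zero_Hom[OF Z] HomD(5)[OF f] unfolding zero_object_def by blast
  show "f = Zero C X Z" if f: "f \<in> Hom C X Z"
    using assms f zero_Hom[OF _ Z] HomD(4)[OF f] unfolding zero_object_def by blast
qed

end

section \<open>Normal monomorphisms and conormal epimorphisms in an abelian category\<close>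

context abelian_category
begin

lemma obtain_kernel:
  assumes "f \<in> Hom C X Y"
  obtains K k where "k \<in> Hom C K X" "is_kernel C k f" "f \<cdot> k = Zero C K Y" "is_mono C k"
  using ex_kernel[of f] HomD[OF assms] is_kernelD assms kernel_mono by metis

lemma obtain_cokernel:
  assumes "f \<in> Hom C X Y"
  obtains Q c where "c \<in> Hom C Y Q" "is_cokernel C c f" "c \<cdot> f = Zero C X Q" "is_epi C c"
  using ex_cokernel[of f] HomD[OF assms] is_cokernelD assms cokernel_epi by metis

text \<open>By normality \<open>m\<close> is the kernel of some \<open>g\<close>, and
  \<open>g\<close> factors through \<open>c\<close>. Whatever \<open>c\<close> kills is therefore
  killed by \<open>g\<close> and factors through \<open>m\<close>.\<close>

lemma mono_is_kernel_of_cokernel: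
  assumes mono: "is_mono C m" and m: "m \<in> Hom C X Y" and coker: "is_cokernel C c m"
  shows "is_kernel C m c"
proof -
  obtain g where ker: "is_kernel C m g" using mono_normal[OF mono] by blast
  note c = is_cokernelD[OF coker m]
  define Z where "Z = Cod C g"
  have g: "g \<in> Hom C Y Z" using ker HomD[OF m] by (auto simp: is_kernel_def Hom_def Z_def)
  have "g \<cdot> m = Zero C X Z" using is_kernelD[OF ker g] HomD[OF m] by simp
  then obtain h where h: "h \<in> Hom C (Cod C c) Z" "h \<cdot> c = g" using cokernel_factor[OF coker m g] by blast
  have "\<exists>!l. l \<in> Hom C T X \<and> m \<cdot> l = t"
    if t: "t \<in> Hom C T Y" and ct: "c \<cdot> t = Zero C T (Cod C c)" for T t
  proof -
    have "g \<cdot> t = Zero C T Z"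
      using Comp_assoc[OF t c(1) h(1)] h(2) ct comp_zero[OF h(1)] HomD[OF t] by simp
    then obtain l where "l \<in> Hom C T X" "m \<cdot> l = t"
      using kernel_factor[OF ker g t] HomD[OF m] by metis
    then show ?thesis using mono_cancel[OF mono m] by metis
  qed
  then show ?thesis using HomD[OF m] HomD[OF c(1)] c(2) unfolding is_kernel_def by simp
qed

text \<open>Dual argument: \<open>e\<close> is the cokernel of some \<open>g\<close>, and
  \<open>g\<close> factors through the kernel \<open>k\<close>.\<close>

lemma epi_is_cokernel_of_kernel:
  assumes epi: "is_epi C e" and e: "e \<in> Hom C X Y" and ker: "is_kernel C k e"
  shows "is_cokernel C e k"
proof -
  obtain g where coker: "is_cokernel C e g" using epi_conormal[OF epi] by blast
  note k = is_kernelD[OF ker e]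
  define Z where "Z = Dom C g"
  have g: "g \<in> Hom C Z X" using coker HomD[OF e] by (auto simp: is_cokernel_def Hom_def Z_def)
  have "e \<cdot> g = Zero C Z Y" using is_cokernelD[OF coker g] HomD[OF e] by simp
  then obtain h where h: "h \<in> Hom C Z (Dom C k)" "k \<cdot> h = g" using kernel_factor[OF ker e g] by blast
  have "\<exists>!l. l \<in> Hom C Y T \<and> l \<cdot> e = t"
    if t: "t \<in> Hom C X T" and tk: "t \<cdot> k = Zero C (Dom C k) T" for T t
  proof -
    have "t \<cdot> g = Zero C Z T"
      using Comp_assoc[OF h(1) k(1) t] h(2) tk zero_comp[OF h(1)] HomD[OF t] by simp
    then obtain l where "l \<in> Hom C Y T" "l \<cdot> e = t"
      using cokernel_factor[OF coker g t] HomD[OF e] by metis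
    then show ?thesis using epi_cancel[OF epi e] by metis
  qed
  then show ?thesis using HomD[OF e] HomD[OF k(1)] k(2) unfolding is_cokernel_def by simp
qed

text \<open>Since \<open>n\<close> is the kernel of its cokernel, inclusion of subobjects becomes an
  equation between arrows.\<close>

lemma sub_le_iff_cokernel:
  assumes n: "is_mono C n" "n \<in> Hom C Y E" and coker: "is_cokernel C c n" and m: "m \<in> Hom C X E"
  shows "sub_le C m n \<longleftrightarrow> c \<cdot> m = Zero C X (Cod C c)"
proof
  note c = is_cokernelD[OF coker n(2)]
  note ker = mono_is_kernel_of_cokernel[OF n coker]
  show "c \<cdot> m = Zero C X (Cod C c)" if le: "sub_le C m n"
  proof -
    obtain h where h: "h \<in> Hom C X Y" "n \<cdot> h = m" using sub_leE[OF le m n(2)] .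
    show ?thesis using Comp_assoc[OF h(1) n(2) c(1)] h(2) c(2) zero_comp[OF h(1)] HomD[OF c(1)] by simp
  qed
  show "sub_le C m n" if z: "c \<cdot> m = Zero C X (Cod C c)"
  proof -
    obtain h where h: "h \<in> Hom C X (Dom C n)" "n \<cdot> h = m" using kernel_factor[OF ker c(1) m z] .
    show ?thesis using sub_leI[OF n(2) _ h(2)] h(1) HomD[OF n(2)] by simp
  qed
qed

end

section \<open>Disjoint subobjects\<close>

text \<open>Trivial intersection, tested on arrows from arbitrary objects instead of on a chosen
  pullback. If \<open>m\<close> is a monomorphism, vanishing of \<open>m \<cdot> a\<close> amounts
  to vanishing of \<open>a\<close>.\<close>

definition disjoint_sub :: "('o, 'm, 'z) abcat_scheme \<Rightarrow> 'm \<Rightarrow> 'm \<Rightarrow> bool" where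
  "disjoint_sub C m n \<longleftrightarrow> (\<forall>T. \<forall>a \<in> Hom C T (Dom C m). \<forall>b \<in> Hom C T (Dom C n).
    m \<cdot>\<^bsub>C\<^esub> a = n \<cdot>\<^bsub>C\<^esub> b \<longrightarrow> m \<cdot>\<^bsub>C\<^esub> a = Zero C T (Cod C m))"

context abelian_category
begin

lemma disjoint_subI:
  assumes "m \<in> Hom C X E" "n \<in> Hom C Y E"
    and "\<And>T a b. a \<in> Hom C T X \<Longrightarrow> b \<in> Hom C T Y \<Longrightarrow> m \<cdot> a = n \<cdot> b \<Longrightarrow> m \<cdot> a = Zero C T E"
  shows "disjoint_sub C m n"
  using assms(3) HomD[OF assms(1)] HomD[OF assms(2)] unfolding disjoint_sub_def by blast

lemma disjoint_subD:
  assumes "disjoint_sub C m n" "m \<in> Hom C X E" "n \<in> Hom C Y E"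
    and "a \<in> Hom C T X" "b \<in> Hom C T Y" "m \<cdot> a = n \<cdot> b"
  shows "m \<cdot> a = Zero C T E"
  using assms HomD[OF assms(2)] HomD[OF assms(3)] unfolding disjoint_sub_def by blast

lemma disjoint_sub_sym:
  assumes "disjoint_sub C m n" "m \<in> Hom C X E" "n \<in> Hom C Y E"
  shows "disjoint_sub C n m"
  by (rule disjoint_subI[OF assms(3,2)]) (metis disjoint_subD[OF assms])

text \<open>What \<open>c \<cdot> m\<close> kills is what \<open>m\<close> sends into the kernel
  \<open>n\<close> of \<open>c\<close>, that is, the intersection. This is the form in which
  disjointness can pass to a limit.\<close>

lemma disjoint_sub_iff_mono:
  assumes m: "is_mono C m" "m \<in> Hom C X E" and n: "is_mono C n" "n \<in> Hom C Y E"
    and coker: "is_cokernel C c n"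
  shows "disjoint_sub C m n \<longleftrightarrow> is_mono C (c \<cdot> m)"
proof
  note c = is_cokernelD[OF coker n(2)]
  define Q where "Q = Cod C c"
  have c1: "c \<in> Hom C E Q" and c2: "c \<cdot> n = Zero C Y Q" using c by (auto simp: Q_def)
  note ker = mono_is_kernel_of_cokernel[OF n coker]
  show "is_mono C (c \<cdot> m)" if d: "disjoint_sub C m n"
  proof (rule mono_if_zero_cancel[OF Comp_Hom[OF m(2) c1]])
    fix T t assume t: "t \<in> Hom C T X" and z: "(c \<cdot> m) \<cdot> t = Zero C T Q"
    have "c \<cdot> (m \<cdot> t) = Zero C T Q" using z Comp_assoc[OF t m(2) c1] by simp
    then obtain b where b: "b \<in> Hom C T Y" "n \<cdot> b = m \<cdot> t"
      using kernel_factor[OF ker c1 Comp_Hom[OF t m(2)]] HomD[OF n(2)] by metis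
    show "t = Zero C T X"
      by (rule mono_zero_cancel[OF m t], rule disjoint_subD[OF d m(2) n(2) t b(1)]) (use b in simp)
  qed
  show "disjoint_sub C m n" if mono: "is_mono C (c \<cdot> m)"
  proof (rule disjoint_subI[OF m(2) n(2)])
    fix T a b assume a: "a \<in> Hom C T X" and b: "b \<in> Hom C T Y" and eq: "m \<cdot> a = n \<cdot> b"
    have "(c \<cdot> m) \<cdot> a = Zero C T Q"
      using Comp_assoc[OF a m(2) c1] eq Comp_assoc[OF b n(2) c1] c2 zero_comp[OF b] HomD[OF c1] by simp
    then have "a = Zero C T X" by (rule mono_zero_cancel[OF mono Comp_Hom[OF m(2) c1] a])
    then show "m \<cdot> a = Zero C T E" using comp_zero[OF m(2)] HomD[OF a] by simp
  qed
qed

lemma disjoint_zero_sub: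
  assumes m: "m \<in> Hom C X E" and Y: "Y \<in> Obj C"
  shows "disjoint_sub C (Zero C Y E) m"
  by (rule disjoint_subI[OF zero_Hom m]) (use Y HomD[OF m] zero_comp in auto)

text \<open>Replaces the pullbacks in the definition of essentiality by \<open>disjoint_sub\<close>,
  the form used from here on.\<close>

lemma essential_mono_iff:
  assumes m: "m \<in> Hom C X E"
  shows "essential_mono C m \<longleftrightarrow> is_mono C m \<and>
    (\<forall>Y n. n \<in> Hom C Y E \<longrightarrow> is_mono C n \<longrightarrow> disjoint_sub C n m \<longrightarrow> n = Zero C Y E)"
proof (intro iffI conjI allI impI)
  assume ess: "essential_mono C m"
  then show mono: "is_mono C m" by (simp add: essential_mono_def)
  fix Y n assume n: "n \<in> Hom C Y E" "is_mono C n" and d: "disjoint_sub C n m"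
  obtain Z where Z: "zero_object C Z" using ex_zero_object by blast
  have Zo: "Z \<in> Obj C" using Z by (simp add: zero_object_def)
  \<comment> \<open>For disjoint subobjects the zero object with zero arrows is a pullback: every
    commuting test pair consists of zero arrows.\<close>
  let ?p = "Zero C Z X" and ?q = "Zero C Z Y"
  have p: "?p \<in> Hom C Z X" and q: "?q \<in> Hom C Z Y" using zero_Hom Zo HomD[OF m] HomD[OF n(1)] by auto
  have "\<exists>!h. h \<in> Hom C T Z \<and> ?p \<cdot> h = a \<and> ?q \<cdot> h = b"
    if a: "a \<in> Hom C T X" and b: "b \<in> Hom C T Y" and eq: "m \<cdot> a = n \<cdot> b" for T a b
  proof -
    have "n \<cdot> b = Zero C T E" using disjoint_subD[OF d n(1) m b a] eq by simp
    then have a0: "a = Zero C T X" and b0: "b = Zero C T Y"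
      using mono_zero_cancel[OF mono m a] mono_zero_cancel[OF n(2,1) b] eq by auto
    have T: "T \<in> Obj C" using HomD[OF a] by simp
    have z: "Zero C T Z \<in> Hom C T Z" using T Zo by (rule zero_Hom)
    show ?thesis
      using z comp_zero[OF p T] comp_zero[OF q T] a0 b0 zero_object_HomD(2)[OF Z] by metis
  qed
  moreover have "m \<cdot> ?p = n \<cdot> ?q" using comp_zero[OF m Zo] comp_zero[OF n(1) Zo] by simp
  ultimately have "is_pullback C m n ?p ?q"
    using HomD[OF m] HomD[OF n(1)] HomD[OF p] p q unfolding is_pullback_def by auto
  then have "zero_object C Y"
    using ess Z HomD[OF p] HomD[OF m] HomD[OF n(1)] n(2) unfolding essential_mono_def by metis
  then show "n = Zero C Y E" using zero_object_HomD(1) n(1) by blast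
next
  assume R: "is_mono C m \<and>
    (\<forall>Y n. n \<in> Hom C Y E \<longrightarrow> is_mono C n \<longrightarrow> disjoint_sub C n m \<longrightarrow> n = Zero C Y E)"
  show "essential_mono C m"
    unfolding essential_mono_def
  proof (intro conjI allI impI)
    show "is_mono C m" using R by simp
    fix n p q
    assume H: "is_mono C n \<and> Cod C n = Cod C m \<and> is_pullback C m n p q \<and> zero_object C (Dom C p)"
    define Y where "Y = Dom C n"
    have n: "n \<in> Hom C Y E" "is_mono C n" using H HomD[OF m] by (auto simp: is_mono_def Hom_def Y_def)
    have Y: "Y \<in> Obj C" using HomD[OF n(1)] by simp
    have "disjoint_sub C n m"
    proof (rule disjoint_subI[OF n(1) m])
      fix T b a assume b: "b \<in> Hom C T Y" and a: "a \<in> Hom C T X" and eq: "n \<cdot> b = m \<cdot> a"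
      have T: "T \<in> Obj C" using HomD[OF a] by simp
      have "\<exists>!h. h \<in> Hom C T (Dom C p) \<and> p \<cdot> h = a \<and> q \<cdot> h = b"
        using H a b eq T HomD[OF m] HomD[OF n(1)] unfolding is_pullback_def by simp
      then obtain h where h: "h \<in> Hom C T (Dom C p)" "p \<cdot> h = a" by blast
      have "p \<in> Hom C (Dom C p) (Dom C m)" using H unfolding is_pullback_def by blast
      then have p: "p \<in> Hom C (Dom C p) X" by (simp only: HomD(2)[OF m])
      have "h = Zero C T (Dom C p)" using zero_object_HomD(2)[OF _ h(1)] H by simp
      then have "a = Zero C T X" using h(2) comp_zero[OF p T] by simp
      then show "n \<cdot> b = Zero C T E" using eq comp_zero[OF m T] by simp
    qed
    then have n0: "n = Zero C Y E" using R n by blast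
    have "Ident C Y = Zero C Y Y"
      using mono_zero_cancel[OF n(2,1) Ident_Hom[OF Y]] n0 Comp_Ident[OF n(1)] by simp
    then show "zero_object C (Dom C n)" using zero_object_iff_Ident[OF Y] by (simp add: Y_def)
  qed
qed

end

section \<open>Joins of directed families of subobjects\<close>

text \<open>\<open>c\<close> is the quotient of \<open>E\<close> by the join of the family \<open>n\<close>, so the join itself is the kernel of \<open>c\<close>.\<close>

definition joint_cokernel ::
  "('o, 'm, 'z) abcat_scheme \<Rightarrow> 'i set \<Rightarrow> ('i \<Rightarrow> 'm) \<Rightarrow> 'o \<Rightarrow> 'm \<Rightarrow> bool" where
  "joint_cokernel C I n E c \<longleftrightarrow> c \<in> Hom C E (Cod C c) \<and>
    (\<forall>i \<in> I. c \<cdot>\<^bsub>C\<^esub> n i = Zero C (Dom C (n i)) (Cod C c)) \<and>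
    (\<forall>T \<in> Obj C. \<forall>f \<in> Hom C E T. (\<forall>i \<in> I. f \<cdot>\<^bsub>C\<^esub> n i = Zero C (Dom C (n i)) T) \<longrightarrow>
      (\<exists>!h. h \<in> Hom C (Cod C c) T \<and> h \<cdot>\<^bsub>C\<^esub> c = f))"

text \<open>The index set carries the preorder of inclusion between the subobjects themselves, so
  different indices may name the same subobject.\<close>

definition directed_subobjects ::
  "('o, 'm, 'z) cat_scheme \<Rightarrow> 'o \<Rightarrow> 'i set \<Rightarrow> ('i \<Rightarrow> 'm) \<Rightarrow> bool" where
  "directed_subobjects C E I n \<longleftrightarrow> (\<forall>i \<in> I. is_mono C (n i) \<and> n i \<in> Hom C (Dom C (n i)) E) \<and>
    directed_on I {(i, j). i \<in> I \<and> j \<in> I \<and> sub_le C (n i) (n j)}"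

text \<open>All objects of the system are quotients of one \<open>E\<close>, so identities between
  arrows out of them can be checked after composing with \<open>e i\<close>. A cocone is then a
  single arrow out of \<open>E\<close> that factors through every \<open>e i\<close>, and the
  universal property reduces to \<open>univ\<close>.\<close>

lemma (in category) direct_limit_of_quotients:
  assumes dir: "directed_on I r"
    and e: "\<And>i. i \<in> I \<Longrightarrow> e i \<in> Hom C E (Y i)" and epi: "\<And>i. i \<in> I \<Longrightarrow> is_epi C (e i)"
    and \<psi>: "\<And>i j. (i, j) \<in> r \<Longrightarrow> \<psi> i j \<in> Hom C (Y i) (Y j)"
    and \<psi>e: "\<And>i j. (i, j) \<in> r \<Longrightarrow> \<psi> i j \<cdot> e i = e j"
    and q: "q \<in> Hom C E Q" "is_epi C q"
    and v: "\<And>i. i \<in> I \<Longrightarrow> v i \<in> Hom C (Y i) Q"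
    and ve: "\<And>i. i \<in> I \<Longrightarrow> v i \<cdot> e i = q"
    and univ: "\<And>T f a. f \<in> Hom C E T \<Longrightarrow> (\<And>i. i \<in> I \<Longrightarrow> a i \<in> Hom C (Y i) T \<and> a i \<cdot> e i = f) \<Longrightarrow>
      \<exists>h \<in> Hom C Q T. h \<cdot> q = f"
  shows "is_direct_limit C I r Y \<psi> Q v"
proof -
  have rI: "i \<in> I" "j \<in> I" if "(i, j) \<in> r" for i j
    using dir that unfolding directed_on_def preorder_on_def by auto
  have refl: "(i, i) \<in> r" if "i \<in> I" for i
    using dir that unfolding directed_on_def preorder_on_def refl_on_def by auto
  have trans: "(i, k) \<in> r" if "(i, j) \<in> r" "(j, k) \<in> r" for i j k
    using dir that unfolding directed_on_def preorder_on_def trans_def by blast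
  obtain i0 where i0: "i0 \<in> I" using dir unfolding directed_on_def by blast
  have Y: "Y i \<in> Obj C" if "i \<in> I" for i using HomD[OF e[OF that]] by simp
  have factor: "a \<cdot> \<psi> i j = b" if ij: "(i, j) \<in> r" and a: "a \<in> Hom C (Y j) T" and b: "b \<in> Hom C (Y i) T"
    and eq: "a \<cdot> e j = b \<cdot> e i" for a b i j T
    by (rule epi_cancel[OF epi e Comp_Hom[OF \<psi> a] b])
      (use rI[OF ij] ij eq \<psi>e[OF ij] Comp_assoc[OF e \<psi> a] in auto)
  have "direct_system C I r Y \<psi>"
    unfolding direct_system_def
  proof (intro conjI allI impI ballI)
    fix i assume i: "i \<in> I"
    show "\<psi> i i = Ident C (Y i)"
      by (rule epi_cancel[OF epi[OF i] e[OF i] \<psi>[OF refl[OF i]] Ident_Hom[OF Y[OF i]]])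
        (use \<psi>e[OF refl[OF i]] Ident_Comp[OF e[OF i]] in simp)
  next
    fix i j k assume ij: "(i, j) \<in> r" and jk: "(j, k) \<in> r"
    show "\<psi> j k \<cdot> \<psi> i j = \<psi> i k"
      by (rule factor[OF ij \<psi>[OF jk] \<psi>[OF trans[OF ij jk]]])
        (use \<psi>e ij jk trans[OF ij jk] in simp)
  qed (use dir Y \<psi> in auto)
  moreover have "cocone C I r Y \<psi> Q v"
    unfolding cocone_def
  proof (intro conjI allI impI ballI)
    fix i j assume ij: "(i, j) \<in> r"
    show "v j \<cdot> \<psi> i j = v i"
      by (rule factor[OF ij v v]) (use rI[OF ij] ve in auto)
  qed (use HomD[OF q(1)] v in auto)
  moreover have "\<exists>!h. h \<in> Hom C Q T \<and> (\<forall>i \<in> I. h \<cdot> v i = a i)" if "cocone C I r Y \<psi> T a" for T a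
  proof -
    have a: "a i \<in> Hom C (Y i) T" if "i \<in> I" for i
      using \<open>cocone C I r Y \<psi> T a\<close> that unfolding cocone_def by blast
    have a\<psi>: "a j \<cdot> \<psi> i j = a i" if "(i, j) \<in> r" for i j
      using \<open>cocone C I r Y \<psi> T a\<close> that unfolding cocone_def by blast
    have step: "a i \<cdot> e i = a j \<cdot> e j" if ij: "(i, j) \<in> r" for i j
      using Comp_assoc[OF e[OF rI(1)[OF ij]] \<psi>[OF ij] a[OF rI(2)[OF ij]]] a\<psi>[OF ij] \<psi>e[OF ij] by simp
    \<comment> \<open>A common upper bound of \<open>i\<close> and \<open>i0\<close> shows that the
      arrow out of \<open>E\<close> does not depend on the index.\<close>
    have const: "a i \<cdot> e i = a i0 \<cdot> e i0" if i: "i \<in> I" for i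
    proof -
      obtain k where "(i, k) \<in> r" "(i0, k) \<in> r" using dir i i0 unfolding directed_on_def by blast
      then show ?thesis using step[of i k] step[of i0 k] by simp
    qed
    obtain h where h: "h \<in> Hom C Q T" "h \<cdot> q = a i0 \<cdot> e i0"
      using univ[OF Comp_Hom[OF e[OF i0] a[OF i0]], of a] a const by blast
    have hv: "h \<cdot> v i = a i" if i: "i \<in> I" for i
      by (rule epi_cancel[OF epi[OF i] e[OF i] Comp_Hom[OF v[OF i] h(1)] a[OF i]])
        (use Comp_assoc[OF e[OF i] v[OF i] h(1)] ve[OF i] h(2) const[OF i] in simp)
    have "h' = h" if h': "h' \<in> Hom C Q T" "\<forall>i \<in> I. h' \<cdot> v i = a i" for h'
      by (rule epi_cancel[OF q(2,1) h'(1) h(1)])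
        (use Comp_assoc[OF e[OF i0] v[OF i0] h'(1)] ve[OF i0] h'(2) i0 h(2) in simp)
    then show ?thesis using h(1) hv by blast
  qed
  ultimately show ?thesis unfolding is_direct_limit_def by blast
qed

context abelian_category
begin

lemma joint_cokernelD:
  assumes "joint_cokernel C I n E c"
  shows "c \<in> Hom C E (Cod C c)" "i \<in> I \<Longrightarrow> c \<cdot> n i = Zero C (Dom C (n i)) (Cod C c)"
  using assms unfolding joint_cokernel_def by auto

lemma joint_cokernel_factor:
  assumes "joint_cokernel C I n E c" "f \<in> Hom C E T"
    and "\<And>i. i \<in> I \<Longrightarrow> f \<cdot> n i = Zero C (Dom C (n i)) T"
  obtains h where "h \<in> Hom C (Cod C c) T" "h \<cdot> c = f"
  using assms HomD(5)[OF assms(2)] unfolding joint_cokernel_def by blast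

text \<open>Uniqueness in the universal property, applied to \<open>g \<cdot> c\<close>, which kills
  every \<open>n i\<close>.\<close>

lemma joint_cokernel_epi:
  assumes jc: "joint_cokernel C I n E c"
    and n: "\<And>i. i \<in> I \<Longrightarrow> n i \<in> Hom C (Dom C (n i)) E"
  shows "is_epi C c"
proof -
  note c = joint_cokernelD[OF jc]
  have "g = h" if g: "g \<in> Hom C (Cod C c) T" and h: "h \<in> Hom C (Cod C c) T" and eq: "g \<cdot> c = h \<cdot> c"
    for T g h
  proof -
    have "(g \<cdot> c) \<cdot> n i = Zero C (Dom C (n i)) T" if i: "i \<in> I" for i
      using Comp_assoc[OF n[OF i] c(1) g] c(2)[OF i] comp_zero[OF g] HomD[OF n[OF i]] by simp
    moreover have "g \<cdot> c \<in> Hom C E T" using c(1) g by (rule Comp_Hom)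
    moreover have "T \<in> Obj C" using HomD[OF g] by simp
    ultimately have "\<exists>!l. l \<in> Hom C (Cod C c) T \<and> l \<cdot> c = g \<cdot> c"
      using jc unfolding joint_cokernel_def by blast
    then show ?thesis using g h eq by metis
  qed
  then show ?thesis using HomD[OF c(1)] unfolding is_epi_def by auto
qed

end

section \<open>Joins of small families and exactness of direct limits\<close>

context grothendieck_category
begin

text \<open>The members of the family induce one arrow \<open>\<sigma>\<close> out of the coproduct
  of their domains. An arrow kills \<open>\<sigma>\<close> exactly when it kills every
  \<open>n i\<close>, so the cokernel of \<open>\<sigma>\<close> serves.\<close>

lemma ex_joint_cokernel:
  fixes I :: "'u set"
  assumes small: "|I| <o \<kappa>" and E: "E \<in> Obj C"
    and n: "\<And>i. i \<in> I \<Longrightarrow> n i \<in> Hom C (Dom C (n i)) E"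
  shows "\<exists>c. joint_cokernel C I n E c"
proof -
  have "Dom C (n i) \<in> Obj C" if "i \<in> I" for i using HomD[OF n[OF that]] by simp
  then obtain S \<iota> where cop: "is_coproduct C I (\<lambda>i. Dom C (n i)) S \<iota>"
    using ex_coproduct[OF small, of "\<lambda>i. Dom C (n i)"] by blast
  have S: "S \<in> Obj C" and \<iota>: "\<And>i. i \<in> I \<Longrightarrow> \<iota> i \<in> Hom C (Dom C (n i)) S"
    and univ: "\<And>T a. T \<in> Obj C \<Longrightarrow> (\<And>i. i \<in> I \<Longrightarrow> a i \<in> Hom C (Dom C (n i)) T) \<Longrightarrow>
      \<exists>!h. h \<in> Hom C S T \<and> (\<forall>i \<in> I. h \<cdot> \<iota> i = a i)"
    using cop unfolding is_coproduct_def by auto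
  obtain \<sigma> where \<sigma>: "\<sigma> \<in> Hom C S E" "\<And>i. i \<in> I \<Longrightarrow> \<sigma> \<cdot> \<iota> i = n i"
    using univ[OF E n] by blast
  obtain Q c where c: "c \<in> Hom C E Q" "is_cokernel C c \<sigma>" "c \<cdot> \<sigma> = Zero C S Q" "is_epi C c"
    using obtain_cokernel[OF \<sigma>(1)] by blast
  have "c \<cdot> n i = Zero C (Dom C (n i)) Q" if i: "i \<in> I" for i
    using Comp_assoc[OF \<iota>[OF i] \<sigma>(1) c(1)] \<sigma>(2)[OF i] c(3) zero_comp[OF \<iota>[OF i]] HomD[OF c(1)] by simp
  moreover have "\<exists>!h. h \<in> Hom C Q T \<and> h \<cdot> c = f"
    if f: "f \<in> Hom C E T" and fn: "\<forall>i \<in> I. f \<cdot> n i = Zero C (Dom C (n i)) T" for T f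
  proof -
    have T: "T \<in> Obj C" using HomD[OF f] by simp
    have z: "Zero C S T \<in> Hom C S T" using S T by (rule zero_Hom)
    have "\<exists>!h. h \<in> Hom C S T \<and> (\<forall>i \<in> I. h \<cdot> \<iota> i = Zero C (Dom C (n i)) T)"
      by (rule univ[OF T zero_Hom]) (use HomD[OF n] T in auto)
    moreover have "f \<cdot> \<sigma> \<in> Hom C S T" using \<sigma>(1) f by (rule Comp_Hom)
    moreover have "\<forall>i \<in> I. (f \<cdot> \<sigma>) \<cdot> \<iota> i = Zero C (Dom C (n i)) T"
      using Comp_assoc[OF \<iota> \<sigma>(1) f] \<sigma>(2) fn by simp
    moreover have "\<forall>i \<in> I. Zero C S T \<cdot> \<iota> i = Zero C (Dom C (n i)) T"
      using zero_comp[OF \<iota> T] by simp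
    ultimately have "f \<cdot> \<sigma> = Zero C S T" using z by blast
    then obtain h where "h \<in> Hom C (Cod C c) T" "h \<cdot> c = f"
      using cokernel_factor[OF c(2) \<sigma>(1) f] by blast
    then show ?thesis using epi_cancel[OF c(4,1)] HomD[OF c(1)] by metis
  qed
  ultimately show ?thesis using c(1) HomD[OF c(1)] unfolding joint_cokernel_def by metis
qed

text \<open>
  This is where direct limits are exact: the constant system \<open>P\<close> embeds into the system of the
  quotients of \<open>E\<close> by the \<open>n i\<close>, whose limit is the quotient of \<open>E\<close> by the join of the \<open>n i\<close>.
\<close>

lemma directed_join_disjoint:
  fixes I :: "'u set"
  assumes small: "|I| <o \<kappa>" and dir: "directed_subobjects C E I n" and jc: "joint_cokernel C I n E c"
    and p: "is_mono C p" "p \<in> Hom C P E" and disj: "\<And>i. i \<in> I \<Longrightarrow> disjoint_sub C p (n i)"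
  shows "is_mono C (c \<cdot> p)"
proof -
  define r where "r = {(i, j). i \<in> I \<and> j \<in> I \<and> sub_le C (n i) (n j)}"
  have n: "is_mono C (n i)" "n i \<in> Hom C (Dom C (n i)) E" if "i \<in> I" for i
    using dir that unfolding directed_subobjects_def by auto
  have dr: "directed_on I r" using dir unfolding directed_subobjects_def r_def by simp
  obtain i0 where i0: "i0 \<in> I" using dr unfolding directed_on_def by blast
  have rI: "i \<in> I" "j \<in> I" if "(i, j) \<in> r" for i j using that unfolding r_def by auto
  define Q where "Q = Cod C c"
  have c: "c \<in> Hom C E Q" "\<And>i. i \<in> I \<Longrightarrow> c \<cdot> n i = Zero C (Dom C (n i)) Q" "is_epi C c"
    using joint_cokernelD[OF jc] joint_cokernel_epi[OF jc n(2)] unfolding Q_def by auto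
  have P: "P \<in> Obj C" using HomD[OF p(2)] by simp
  \<comment> \<open>\<open>Y i\<close> is the quotient of \<open>E\<close> by \<open>n i\<close>.
    The transition arrows \<open>\<psi> i j\<close> come from the inclusions, and \<open>v i\<close>
    leads on to the quotient by the join.\<close>
  have "\<exists>q. \<forall>i \<in> I. is_cokernel C (q i) (n i)"
    by (intro bchoice ballI ex_cokernel HomD(1)[OF n(2)])
  then obtain q where q: "\<And>i. i \<in> I \<Longrightarrow> is_cokernel C (q i) (n i)" by blast
  define Y where "Y i = Cod C (q i)" for i
  have qh: "q i \<in> Hom C E (Y i)" "q i \<cdot> n i = Zero C (Dom C (n i)) (Y i)" "is_epi C (q i)" if "i \<in> I" for i
    using is_cokernelD[OF q[OF that] n(2)[OF that]] cokernel_epi[OF q[OF that]] by (auto simp: Y_def)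
  have qp: "q i \<cdot> p \<in> Hom C P (Y i)" if "i \<in> I" for i using p(2) qh(1)[OF that] by (rule Comp_Hom)
  have "\<exists>h \<in> Hom C (Y i) (Y j). h \<cdot> q i = q j" if ij: "(i, j) \<in> r" for i j
  proof -
    have "sub_le C (n i) (n j)" using ij by (simp add: r_def)
    then have "q j \<cdot> n i = Zero C (Dom C (n i)) (Y j)"
      using sub_le_iff_cokernel[OF n[OF rI(2)[OF ij]] q[OF rI(2)[OF ij]] n(2)[OF rI(1)[OF ij]]]
      by (simp add: Y_def)
    then show ?thesis
      using cokernel_factor[OF q[OF rI(1)[OF ij]] n(2)[OF rI(1)[OF ij]] qh(1)[OF rI(2)[OF ij]]]
      unfolding Y_def by metis
  qed
  then obtain \<psi> where \<psi>: "\<And>i j. (i, j) \<in> r \<Longrightarrow> \<psi> i j \<in> Hom C (Y i) (Y j)"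
    "\<And>i j. (i, j) \<in> r \<Longrightarrow> \<psi> i j \<cdot> q i = q j" by metis
  have "\<exists>h \<in> Hom C (Y i) Q. h \<cdot> q i = c" if i: "i \<in> I" for i
    using cokernel_factor[OF q[OF i] n(2)[OF i] c(1) c(2)[OF i]] unfolding Y_def by metis
  then obtain v where v: "\<And>i. i \<in> I \<Longrightarrow> v i \<in> Hom C (Y i) Q" "\<And>i. i \<in> I \<Longrightarrow> v i \<cdot> q i = c" by metis
  \<comment> \<open>\<open>Z i\<close> is the cokernel of \<open>P\<close> in \<open>Y i\<close>,
    that is, the quotient of \<open>E\<close> by \<open>n i\<close> and \<open>p\<close> together;
    below, \<open>N\<close> plays the same role for \<open>Q\<close>.\<close>
  have "\<exists>z. \<forall>i \<in> I. is_cokernel C (z i) (q i \<cdot> p)"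
    by (intro bchoice ballI ex_cokernel HomD(1)[OF qp])
  then obtain z where z: "\<And>i. i \<in> I \<Longrightarrow> is_cokernel C (z i) (q i \<cdot> p)" by blast
  define Z where "Z i = Cod C (z i)" for i
  have zh: "z i \<in> Hom C (Y i) (Z i)" "z i \<cdot> (q i \<cdot> p) = Zero C P (Z i)" "is_epi C (z i)" if "i \<in> I" for i
    using is_cokernelD[OF z[OF that] qp[OF that]] cokernel_epi[OF z[OF that]] by (auto simp: Z_def)
  have "\<exists>h \<in> Hom C (Z i) (Z j). h \<cdot> z i = z j \<cdot> \<psi> i j" if ij: "(i, j) \<in> r" for i j
  proof -
    note i = rI(1)[OF ij] and j = rI(2)[OF ij]
    have zp: "z j \<cdot> \<psi> i j \<in> Hom C (Y i) (Z j)" using \<psi>(1)[OF ij] zh(1)[OF j] by (rule Comp_Hom)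
    have "(z j \<cdot> \<psi> i j) \<cdot> (q i \<cdot> p) = Zero C P (Z j)"
      using Comp_assoc[OF qp[OF i] \<psi>(1)[OF ij] zh(1)[OF j]] zh(2)[OF j]
        Comp_assoc[OF p(2) qh(1)[OF i] \<psi>(1)[OF ij]] \<psi>(2)[OF ij] by simp
    then show ?thesis using cokernel_factor[OF z[OF i] qp[OF i] zp] unfolding Z_def by metis
  qed
  then obtain \<chi> where \<chi>: "\<And>i j. (i, j) \<in> r \<Longrightarrow> \<chi> i j \<in> Hom C (Z i) (Z j)"
    "\<And>i j. (i, j) \<in> r \<Longrightarrow> \<chi> i j \<cdot> z i = z j \<cdot> \<psi> i j" by metis
  have cp: "c \<cdot> p \<in> Hom C P Q" using p(2) c(1) by (rule Comp_Hom)
  obtain N y where y: "y \<in> Hom C Q N" "is_cokernel C y (c \<cdot> p)" "y \<cdot> (c \<cdot> p) = Zero C P N" "is_epi C y"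
    using obtain_cokernel[OF cp] by blast
  have "\<exists>h \<in> Hom C (Z i) N. h \<cdot> z i = y \<cdot> v i" if i: "i \<in> I" for i
  proof -
    have yv: "y \<cdot> v i \<in> Hom C (Y i) N" using v(1)[OF i] y(1) by (rule Comp_Hom)
    have "(y \<cdot> v i) \<cdot> (q i \<cdot> p) = Zero C P N"
      using Comp_assoc[OF qp[OF i] v(1)[OF i] y(1)] y(3)
        Comp_assoc[OF p(2) qh(1)[OF i] v(1)[OF i]] v(2)[OF i] by simp
    then show ?thesis using cokernel_factor[OF z[OF i] qp[OF i] yv] unfolding Z_def by metis
  qed
  then obtain w where w: "\<And>i. i \<in> I \<Longrightarrow> w i \<in> Hom C (Z i) N" "\<And>i. i \<in> I \<Longrightarrow> w i \<cdot> z i = y \<cdot> v i" by metis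
  have idP: "Ident C P \<in> Hom C P P" using P by (rule Ident_Hom)
  have epi_id: "is_epi C (Ident C P)"
    unfolding is_epi_def using HomD[OF idP] Comp_Ident[of _ P] by auto
  \<comment> \<open>The constant system consists of the identity quotients of \<open>P\<close>, so
    the lemma on systems of quotients covers it too.\<close>
  have limX: "is_direct_limit C I r (\<lambda>i. P) (\<lambda>i j. Ident C P) P (\<lambda>i. Ident C P)"
    by (rule direct_limit_of_quotients[OF dr, where e = "\<lambda>i. Ident C P" and E = P and q = "Ident C P"])
      (use idP epi_id Comp_Ident Ident_Comp[OF idP] in auto)
  have limY: "is_direct_limit C I r Y \<psi> Q v"
  proof (rule direct_limit_of_quotients[OF dr qh(1,3) \<psi> c(1,3) v])
    fix T f a assume f: "f \<in> Hom C E T" and a: "\<And>i. i \<in> I \<Longrightarrow> a i \<in> Hom C (Y i) T \<and> a i \<cdot> q i = f"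
    have "f \<cdot> n i = Zero C (Dom C (n i)) T" if i: "i \<in> I" for i
      using Comp_assoc[OF n(2)[OF i] qh(1)[OF i], of "a i" T] a[OF i] qh(2)[OF i]
        comp_zero[of "a i" "Y i" T "Dom C (n i)"] HomD[OF n(2)[OF i]] by simp
    then show "\<exists>h \<in> Hom C Q T. h \<cdot> c = f"
      using joint_cokernel_factor[OF jc f] unfolding Q_def by metis
  qed
  have limZ: "is_direct_limit C I r Z \<chi> N w"
  proof (rule direct_limit_of_quotients[OF dr, where e = "\<lambda>i. z i \<cdot> q i" and E = E and q = "y \<cdot> c"])
    fix i assume i: "i \<in> I"
    show "z i \<cdot> q i \<in> Hom C E (Z i)" using qh(1)[OF i] zh(1)[OF i] by (rule Comp_Hom)
    show "is_epi C (z i \<cdot> q i)" using qh(3,1)[OF i] zh(3,1)[OF i] by (rule epi_comp)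
    show "w i \<in> Hom C (Z i) N" using w i by blast
    show "w i \<cdot> (z i \<cdot> q i) = y \<cdot> c"
      using Comp_assoc[OF qh(1)[OF i] zh(1)[OF i] w(1)[OF i]] w(2)[OF i]
        Comp_assoc[OF qh(1)[OF i] v(1)[OF i] y(1)] v(2)[OF i] by simp
  next
    fix i j assume ij: "(i, j) \<in> r"
    note i = rI(1)[OF ij] and j = rI(2)[OF ij]
    show "\<chi> i j \<in> Hom C (Z i) (Z j)" using \<chi> ij by blast
    show "\<chi> i j \<cdot> (z i \<cdot> q i) = z j \<cdot> q j"
      using Comp_assoc[OF qh(1)[OF i] zh(1)[OF i] \<chi>(1)[OF ij]] \<chi>(2)[OF ij]
        Comp_assoc[OF qh(1)[OF i] \<psi>(1)[OF ij] zh(1)[OF j]] \<psi>(2)[OF ij] by simp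
  next
    show "y \<cdot> c \<in> Hom C E N" using c(1) y(1) by (rule Comp_Hom)
    show "is_epi C (y \<cdot> c)" using c(3,1) y(4,1) by (rule epi_comp)
  next
    \<comment> \<open>Such an \<open>f\<close> kills all \<open>n i\<close> as well as
      \<open>p\<close>; it factors first through \<open>c\<close> and then through
      \<open>y\<close>.\<close>
    fix T f a
    assume f: "f \<in> Hom C E T" and a: "\<And>i. i \<in> I \<Longrightarrow> a i \<in> Hom C (Z i) T \<and> a i \<cdot> (z i \<cdot> q i) = f"
    have T: "T \<in> Obj C" using HomD[OF f] by simp
    have fq: "f = (a i \<cdot> z i) \<cdot> q i" and az: "a i \<cdot> z i \<in> Hom C (Y i) T" if i: "i \<in> I" for i
      using Comp_assoc[OF qh(1)[OF i] zh(1)[OF i], of "a i" T] a[OF i] Comp_Hom[OF zh(1)[OF i], of "a i" T] by auto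
    have "f \<cdot> n i = Zero C (Dom C (n i)) T" if i: "i \<in> I" for i
      using Comp_assoc[OF n(2)[OF i] qh(1)[OF i] az[OF i]] fq[OF i] qh(2)[OF i]
        comp_zero[OF az[OF i]] HomD[OF n(2)[OF i]] by simp
    then obtain h where h: "h \<in> Hom C Q T" "h \<cdot> c = f"
      using joint_cokernel_factor[OF jc f] unfolding Q_def by metis
    have "f \<cdot> p = Zero C P T"
      using fq[OF i0] Comp_assoc[OF p(2) qh(1)[OF i0] az[OF i0]]
        Comp_assoc[OF qp[OF i0] zh(1)[OF i0], of "a i0" T] a[OF i0] zh(2)[OF i0]
        comp_zero[of "a i0" "Z i0" T P] P by simp
    then have "h \<cdot> (c \<cdot> p) = Zero C P T" using Comp_assoc[OF p(2) c(1) h(1)] h(2) by simp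
    then obtain k where k: "k \<in> Hom C N T" "k \<cdot> y = h"
      using cokernel_factor[OF y(2) cp h(1)] HomD[OF y(1)] by metis
    then show "\<exists>h \<in> Hom C N T. h \<cdot> (y \<cdot> c) = f" using Comp_assoc[OF c(1) y(1) k(1)] h(2) by metis
  qed
  have "short_exact C (c \<cdot> p) y"
  proof (rule direct_limit_exact[OF small limX limY limZ, where f = "\<lambda>i. q i \<cdot> p" and g = z])
    show "system_morphism C I r (\<lambda>i. P) (\<lambda>i j. Ident C P) Y \<psi> (\<lambda>i. q i \<cdot> p)"
      unfolding system_morphism_def
    proof (intro conjI allI impI ballI)
      fix i j assume ij: "(i, j) \<in> r"
      show "\<psi> i j \<cdot> (q i \<cdot> p) = q j \<cdot> p \<cdot> Ident C P"
        using Comp_assoc[OF p(2) qh(1)[OF rI(1)[OF ij]] \<psi>(1)[OF ij]] \<psi>(2)[OF ij]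
          Comp_Ident[OF qp[OF rI(2)[OF ij]]] by simp
    qed (use qp in auto)
    show "system_morphism C I r Y \<psi> Z \<chi> z"
      unfolding system_morphism_def using zh(1) \<chi>(2) by auto
    fix i assume i: "i \<in> I"
    \<comment> \<open>Disjointness from \<open>n i\<close> enters here: it embeds \<open>P\<close>
      into \<open>Y i\<close>, which gives the exact sequence at stage \<open>i\<close>.\<close>
    have "is_mono C (q i \<cdot> p)"
      using disjoint_sub_iff_mono[OF p n[OF i] q[OF i]] disj[OF i] by simp
    then show "short_exact C (q i \<cdot> p) (z i)"
      unfolding short_exact_def using z[OF i] mono_is_kernel_of_cokernel[OF _ qp[OF i] z[OF i]] by simp
    show "c \<cdot> p \<cdot> Ident C P = v i \<cdot> (q i \<cdot> p)"
      using Comp_Ident[OF cp] Comp_assoc[OF p(2) qh(1)[OF i] v(1)[OF i]] v(2)[OF i] by simp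
    show "y \<cdot> v i = w i \<cdot> z i" using w(2)[OF i] by simp
  qed (use cp y(1) in auto)
  then show ?thesis unfolding short_exact_def by (auto intro: kernel_mono)
qed

section \<open>Maximal subobjects by Zorn's lemma\<close>

lemma small_index_set:
  fixes A :: "'a set"
  assumes "|A| <o \<kappa>"
  obtains I :: "'u set" and g where "g ` I = A" "|I| <o \<kappa>"
proof -
  \<comment> \<open>Coproducts and exact limits are provided for index sets of type
    \<open>'u set\<close>; an injection of \<open>A\<close> into \<open>Field \<kappa>\<close>
    yields one that enumerates \<open>A\<close>.\<close>
  have "|A| \<le>o |Field \<kappa>|"
    using assms card_of_Field_ordIso[OF Card_order]
    by (meson ordIso_symmetric ordLeq_ordIso_trans ordLess_imp_ordLeq)
  then obtain f where f: "inj_on f A" "f ` A \<subseteq> Field \<kappa>" using card_of_ordLeq[of A "Field \<kappa>"] by auto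
  show ?thesis
  proof (rule that[of "inv_into A f" "f ` A"])
    show "inv_into A f ` f ` A = A" using f(1) by simp
    show "|f ` A| <o \<kappa>" using card_of_image assms by (rule ordLeq_ordLess_trans)
  qed
qed

text \<open>If \<open>m\<close> is not below \<open>n\<close>, the cokernel \<open>c\<close> of
  \<open>n\<close> does not kill \<open>m\<close>, and the generator detects this by some
  \<open>h\<close>. But \<open>m \<cdot> h\<close> factors through \<open>n\<close>, so
  \<open>c\<close> kills it.\<close>

lemma sub_le_if_generator:
  assumes G: "generator C G" and m: "m \<in> Hom C X E" and n: "is_mono C n" "n \<in> Hom C Y E"
    and sub: "(\<lambda>h. m \<cdot> h) ` Hom C G X \<subseteq> (\<lambda>h. n \<cdot> h) ` Hom C G Y"
  shows "sub_le C m n"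
proof (rule ccontr)
  assume not: "\<not> sub_le C m n"
  obtain Q c where c: "c \<in> Hom C E Q" "is_cokernel C c n" "c \<cdot> n = Zero C Y Q" "is_epi C c"
    using obtain_cokernel[OF n(2)] by blast
  have XQ: "X \<in> Obj C" "Q \<in> Obj C" using HomD[OF m] HomD[OF c(1)] by auto
  have "c \<cdot> m \<noteq> Zero C X Q" using not sub_le_iff_cokernel[OF n c(2) m] HomD[OF c(1)] by simp
  then obtain h where h: "h \<in> Hom C G X" "(c \<cdot> m) \<cdot> h \<noteq> Zero C X Q \<cdot> h"
    using G XQ Comp_Hom[OF m c(1)] zero_Hom[OF XQ] unfolding generator_def separating_def by blast
  obtain k where k: "k \<in> Hom C G Y" "m \<cdot> h = n \<cdot> k" using sub h(1) by blast
  have "(c \<cdot> m) \<cdot> h = Zero C G Q"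
    using Comp_assoc[OF h(1) m c(1)] k(2) Comp_assoc[OF k(1) n(2) c(1)] c(3) zero_comp[OF k(1) XQ(2)] by simp
  then show False using h(2) zero_comp[OF h(1) XQ(2)] by simp
qed

lemma image_generator_mono:
  assumes le: "sub_le C m n" and m: "m \<in> Hom C X E" and n: "n \<in> Hom C Y E"
  shows "(\<lambda>h. m \<cdot> h) ` Hom C G X \<subseteq> (\<lambda>h. n \<cdot> h) ` Hom C G Y"
proof -
  obtain k where k: "k \<in> Hom C X Y" "n \<cdot> k = m" using sub_leE[OF le m n] .
  show ?thesis
  proof (rule image_subsetI)
    fix h assume h: "h \<in> Hom C G X"
    have "m \<cdot> h = n \<cdot> (k \<cdot> h)" using Comp_assoc[OF h k(1) n] k(2) by simp
    then show "m \<cdot> h \<in> (\<lambda>h. n \<cdot> h) ` Hom C G Y" using Comp_Hom[OF h k(1)] by blast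
  qed
qed

lemma joint_kernel_upper:
  assumes "directed_subobjects C E I n" "joint_cokernel C I n E c" "is_kernel C s c" "i \<in> I"
  shows "sub_le C (n i) s"
proof -
  have n: "n i \<in> Hom C (Dom C (n i)) E" using assms(1,4) unfolding directed_subobjects_def by blast
  note c = joint_cokernelD[OF assms(2)]
  obtain h where "h \<in> Hom C (Dom C (n i)) (Dom C s)" "s \<cdot> h = n i"
    using kernel_factor[OF assms(3) c(1) n c(2)[OF assms(4)]] .
  then show ?thesis by (rule sub_leI[OF is_kernelD(1)[OF assms(3) c(1)]])
qed

text \<open>
  Zorn's lemma needs joins of chains. Only joins of small families exist, but a chain of subobjects has a small subfamily with the same join: view subobjects as subsets of the small set
  \<open>Hom C G E\<close> and choose one member of the chain for each element of their union.
\<close>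

lemma maximal_subobject:
  assumes E: "E \<in> Obj C" and ex: "Pr m0"
    and Pr: "\<And>m. Pr m \<Longrightarrow> is_mono C m \<and> m \<in> Hom C (Dom C m) E"
    and join: "\<And>(I :: 'u set) n c s. |I| <o \<kappa> \<Longrightarrow> directed_subobjects C E I n \<Longrightarrow>
      (\<And>i. i \<in> I \<Longrightarrow> Pr (n i)) \<Longrightarrow> joint_cokernel C I n E c \<Longrightarrow> is_kernel C s c \<Longrightarrow> Pr s"
  obtains m where "Pr m" "\<And>n. Pr n \<Longrightarrow> sub_le C m n \<Longrightarrow> sub_le C n m"
proof -
  obtain G where G: "generator C G" and small: "\<And>X. X \<in> Obj C \<Longrightarrow> |Hom C G X| <o \<kappa>"
    using ex_generator by blast
  have Go: "G \<in> Obj C" using G unfolding generator_def separating_def by simp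
  \<comment> \<open>The arrows from \<open>G\<close> to \<open>E\<close> that factor through
    \<open>m\<close>. This turns \<open>sub_le\<close> into set inclusion, to which Zorn's lemma for
    sets applies.\<close>
  define F where "F m = (\<lambda>h. m \<cdot> h) ` Hom C G (Dom C m)" for m
  have F_iff: "F m \<subseteq> F n \<longleftrightarrow> sub_le C m n" if "Pr m" "Pr n" for m n
  proof -
    have m: "m \<in> Hom C (Dom C m) E" and n: "is_mono C n" "n \<in> Hom C (Dom C n) E" using Pr that by blast+
    show ?thesis
      unfolding F_def using sub_le_if_generator[OF G m n] image_generator_mono[OF _ m n(2), of G] by (rule iffI)
  qed
  have F_sub: "F m \<subseteq> Hom C G E" if "Pr m" for m
    unfolding F_def using Pr[OF that] by (auto intro: Comp_Hom)
  have F_ne: "F m \<noteq> {}" if "Pr m" for m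
    unfolding F_def using zero_Hom[OF Go HomD(4)] Pr[OF that] by blast
  have "\<exists>U \<in> F ` Collect Pr. \<forall>X \<in> \<C>. X \<subseteq> U" if chain: "subset.chain (F ` Collect Pr) \<C>" for \<C>
  proof (cases "\<C> = {}")
    case True
    then show ?thesis using ex by blast
  next
    case False
    have \<C>: "\<exists>m. Pr m \<and> X = F m" if "X \<in> \<C>" for X
      using chain that unfolding subset.chain_def by blast
    have lin: "X \<subseteq> Y \<or> Y \<subseteq> X" if "X \<in> \<C>" "Y \<in> \<C>" for X Y
      using chain that unfolding subset_chain_def by blast
    have "\<Union>\<C> \<subseteq> Hom C G E" using \<C> F_sub by blast
    then have "|\<Union>\<C>| <o \<kappa>" using ordLeq_ordLess_trans[OF card_of_mono1 small[OF E]] by simp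
    then obtain I :: "'u set" and g where I: "g ` I = \<Union>\<C>" "|I| <o \<kappa>" by (rule small_index_set)
    have "\<exists>m. Pr m \<and> F m \<in> \<C> \<and> g i \<in> F m" if "i \<in> I" for i
    proof -
      have "g i \<in> \<Union>\<C>" using that unfolding I(1)[symmetric] by (rule imageI)
      then obtain X where "X \<in> \<C>" "g i \<in> X" by (rule UnionE)
      then show ?thesis using \<C> by blast
    qed
    then obtain n where n: "\<And>i. i \<in> I \<Longrightarrow> Pr (n i)" "\<And>i. i \<in> I \<Longrightarrow> F (n i) \<in> \<C>" "\<And>i. i \<in> I \<Longrightarrow> g i \<in> F (n i)"
      by metis
    \<comment> \<open>No \<open>F m\<close> is empty, since zero arrows exist; so the union of a
      nonempty chain, and with it \<open>I\<close>, is nonempty, as directedness demands.\<close>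
    obtain X where "X \<in> \<C>" using False by blast
    then have "X \<noteq> {}" using \<C> F_ne by metis
    then have ne: "I \<noteq> {}" using I(1) \<open>X \<in> \<C>\<close> by auto
    let ?r = "{(i, j). i \<in> I \<and> j \<in> I \<and> sub_le C (n i) (n j)}"
    have r: "?r = {(i, j). i \<in> I \<and> j \<in> I \<and> F (n i) \<subseteq> F (n j)}" using F_iff[OF n(1) n(1)] by auto
    have "preorder_on I ?r"
      unfolding r preorder_on_def refl_on_def trans_def by blast
    moreover have "\<exists>k \<in> I. (i, k) \<in> ?r \<and> (j, k) \<in> ?r" if "i \<in> I" "j \<in> I" for i j
      unfolding r using lin[of "F (n i)" "F (n j)"] n(2) that by blast
    ultimately have "directed_on I ?r" using ne unfolding directed_on_def by blast
    then have dir: "directed_subobjects C E I n" unfolding directed_subobjects_def using Pr n(1) by blast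
    obtain c where c: "joint_cokernel C I n E c" using ex_joint_cokernel[OF I(2) E] Pr n(1) by blast
    obtain s where s: "is_kernel C s c" using ex_kernel HomD(1)[OF joint_cokernelD(1)[OF c]] by blast
    have Ps: "Pr s" by (rule join[OF I(2) dir n(1) c s])
    \<comment> \<open>Each element of the chain's union is some \<open>g i\<close>, which lies in
      \<open>F (n i)\<close>, and \<open>n i\<close> is below the join \<open>s\<close>.\<close>
    have "X \<subseteq> F s" if X: "X \<in> \<C>" for X
    proof
      fix x assume "x \<in> X"
      then have "x \<in> g ` I" unfolding I(1) using X by (rule UnionI[rotated])
      then obtain i where i: "i \<in> I" "x = g i" by blast
      have "F (n i) \<subseteq> F s" using F_iff[OF n(1)[OF i(1)] Ps] joint_kernel_upper[OF dir c s i(1)] by simp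
      then show "x \<in> F s" using n(3)[OF i(1)] i(2) by blast
    qed
    then show ?thesis using Ps by blast
  qed
  then have "\<exists>M \<in> F ` Collect Pr. \<forall>X \<in> F ` Collect Pr. M \<subseteq> X \<longrightarrow> X = M" by (rule subset_Zorn)
  then obtain m where m: "Pr m" "\<And>n. Pr n \<Longrightarrow> F m \<subseteq> F n \<Longrightarrow> F n = F m" by blast
  show ?thesis by (rule that[OF m(1)]) (use m F_iff in blast)
qed

end

section \<open>Injective envelopes inside an injective object\<close>

text \<open>Essential extensions of \<open>x\<close> inside \<open>E\<close>, with test subobjects
  taken as arrows into \<open>E\<close> rather than into \<open>Dom C m\<close>. This makes it a
  predicate on subobjects of \<open>E\<close>, ready for Zorn's lemma.\<close>

definition essential_over :: "('o, 'm, 'z) abcat_scheme \<Rightarrow> 'o \<Rightarrow> 'm \<Rightarrow> 'm \<Rightarrow> bool" where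
  "essential_over C E x m \<longleftrightarrow> is_mono C m \<and> m \<in> Hom C (Dom C m) E \<and> sub_le C x m \<and>
    (\<forall>T t. t \<in> Hom C T E \<longrightarrow> is_mono C t \<longrightarrow> sub_le C t m \<longrightarrow> disjoint_sub C t x \<longrightarrow> t = Zero C T E)"

section \<open>Essential extensions in an abelian category\<close>

context abelian_category
begin

lemma mono_zero_comp:
  assumes mono: "is_mono C (f \<cdot> t)" and t: "t \<in> Hom C T X" and f: "f \<in> Hom C X Y"
    and z: "f \<cdot> t = Zero C T Y"
  shows "t = Zero C T X"
proof -
  have T: "T \<in> Obj C" using HomD[OF t] by simp
  have ft: "f \<cdot> t \<in> Hom C T Y" using t f by (rule Comp_Hom)
  have "Ident C T = Zero C T T"
    by (rule mono_zero_cancel[OF mono ft Ident_Hom[OF T]]) (use Comp_Ident[OF ft] z in simp)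
  then show ?thesis using Comp_Ident[OF t] comp_zero[OF t T] by simp
qed

text \<open>The kernel \<open>k\<close> of \<open>c \<cdot> t\<close> describes the intersection of
  \<open>t\<close> and \<open>m\<close>. It gives a subobject of \<open>m\<close> disjoint from
  \<open>x\<close>, which vanishes by essentiality.\<close>

lemma essential_over_disjoint:
  assumes ess: "essential_over C E x m" and x: "x \<in> Hom C X E"
    and t: "is_mono C t" "t \<in> Hom C T E" and d: "disjoint_sub C t x"
  shows "disjoint_sub C t m"
proof -
  define M where "M = Dom C m"
  have m: "is_mono C m" "m \<in> Hom C M E" using ess unfolding essential_over_def M_def by auto
  obtain Q c where c: "c \<in> Hom C E Q" "is_cokernel C c m" "c \<cdot> m = Zero C M Q" "is_epi C c"
    using obtain_cokernel[OF m(2)] by blast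
  have ct: "c \<cdot> t \<in> Hom C T Q" using t(2) c(1) by (rule Comp_Hom)
  obtain K k where k: "k \<in> Hom C K T" "is_kernel C k (c \<cdot> t)" "(c \<cdot> t) \<cdot> k = Zero C K Q" "is_mono C k"
    using obtain_kernel[OF ct] by blast
  have tk: "t \<cdot> k \<in> Hom C K E" using k(1) t(2) by (rule Comp_Hom)
  have "sub_le C (t \<cdot> k) m"
    using sub_le_iff_cokernel[OF m c(2) tk] k(3) Comp_assoc[OF k(1) t(2) c(1)] HomD[OF c(1)] by simp
  moreover have "is_mono C (t \<cdot> k)" using k(4,1) t by (rule mono_comp)
  moreover have "disjoint_sub C (t \<cdot> k) x"
  proof (rule disjoint_subI[OF tk x])
    fix S a b assume a: "a \<in> Hom C S K" and b: "b \<in> Hom C S X" and eq: "t \<cdot> k \<cdot> a = x \<cdot> b"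
    show "t \<cdot> k \<cdot> a = Zero C S E"
      using disjoint_subD[OF d t(2) x Comp_Hom[OF a k(1)] b] Comp_assoc[OF a k(1) t(2)] eq by simp
  qed
  ultimately have "t \<cdot> k = Zero C K E" using ess tk unfolding essential_over_def by blast
  then have k0: "k = Zero C K T" by (rule mono_zero_cancel[OF t k(1)])
  have "is_mono C (c \<cdot> t)"
  proof (rule mono_if_zero_cancel[OF ct])
    fix S a assume a: "a \<in> Hom C S T" and z: "(c \<cdot> t) \<cdot> a = Zero C S Q"
    obtain h where "h \<in> Hom C S K" "k \<cdot> h = a" using kernel_factor[OF k(2) ct a z] HomD[OF k(1)] by metis
    then show "a = Zero C S T" using k0 zero_comp HomD[OF t(2)] by metis
  qed
  then show ?thesis using disjoint_sub_iff_mono[OF t m c(2)] by simp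
qed

text \<open>A test subobject of \<open>M\<close> is pushed forward along the monomorphism
  \<open>m\<close>, which preserves disjointness.\<close>

lemma essential_mono_if_essential_over:
  assumes ess: "essential_over C E x m" and m: "m \<in> Hom C M E" and y: "y \<in> Hom C X M"
    and x: "is_mono C x" "m \<cdot> y = x"
  shows "essential_mono C y"
  unfolding essential_mono_iff[OF y]
proof (intro conjI allI impI)
  have mm: "is_mono C m" using ess by (simp add: essential_over_def)
  have xh: "x \<in> Hom C X E" using Comp_Hom[OF y m] x(2) by simp
  show "is_mono C y" using x mono_right_factor[OF _ y m] by simp
  fix T t assume t: "t \<in> Hom C T M" "is_mono C t" and d: "disjoint_sub C t y"
  have mt: "m \<cdot> t \<in> Hom C T E" using t(1) m by (rule Comp_Hom)
  have "disjoint_sub C (m \<cdot> t) x"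
  proof (rule disjoint_subI[OF mt xh])
    fix S a b assume a: "a \<in> Hom C S T" and b: "b \<in> Hom C S X" and eq: "m \<cdot> t \<cdot> a = x \<cdot> b"
    have "m \<cdot> (t \<cdot> a) = m \<cdot> (y \<cdot> b)" using eq Comp_assoc[OF a t(1) m] Comp_assoc[OF b y m] x(2) by simp
    then have "t \<cdot> a = y \<cdot> b" by (rule mono_cancel[OF mm m Comp_Hom[OF a t(1)] Comp_Hom[OF b y]])
    then have "t \<cdot> a = Zero C S M" by (rule disjoint_subD[OF d t(1) y a b])
    then show "m \<cdot> t \<cdot> a = Zero C S E" using Comp_assoc[OF a t(1) m] comp_zero[OF m HomD(4)[OF a]] by simp
  qed
  moreover have "is_mono C (m \<cdot> t)" using t(2,1) mm m by (rule mono_comp)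
  moreover have "sub_le C (m \<cdot> t) m" using sub_leI[OF m t(1)] by simp
  ultimately have "m \<cdot> t = Zero C T E" using ess mt unfolding essential_over_def by blast
  then show "t = Zero C T M" by (rule mono_zero_cancel[OF mm m t(1)])
qed

text \<open>
  If \<open>t\<close> is disjoint from \<open>q \<cdot> m\<close>, then by maximality of \<open>n\<close> the kernel of \<open>q\<close> is that of its composite
  with the cokernel of \<open>t\<close>, and an epimorphism is determined by its kernel.
\<close>

lemma quotient_by_maximal_complement:
  assumes m: "is_mono C m" "m \<in> Hom C M E" and n: "is_mono C n" "n \<in> Hom C N E" and d: "disjoint_sub C m n"
    and max: "\<And>K k. is_mono C k \<Longrightarrow> k \<in> Hom C K E \<Longrightarrow> disjoint_sub C m k \<Longrightarrow> sub_le C n k \<Longrightarrow> sub_le C k n"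
    and q: "q \<in> Hom C E Q" "is_cokernel C q n" "q \<cdot> n = Zero C N Q" "is_epi C q"
  shows "essential_mono C (q \<cdot> m)"
proof -
  have qm: "q \<cdot> m \<in> Hom C M Q" using m(2) q(1) by (rule Comp_Hom)
  have qmm: "is_mono C (q \<cdot> m)" using disjoint_sub_iff_mono[OF m n q(2)] d by simp
  show ?thesis
    unfolding essential_mono_iff[OF qm]
  proof (intro conjI allI impI qmm)
    fix T t assume t: "t \<in> Hom C T Q" "is_mono C t" and dt: "disjoint_sub C t (q \<cdot> m)"
    obtain R e where e: "e \<in> Hom C Q R" "is_cokernel C e t" "e \<cdot> t = Zero C T R" "is_epi C e"
      using obtain_cokernel[OF t(1)] by blast
    have eq: "e \<cdot> q \<in> Hom C E R" using q(1) e(1) by (rule Comp_Hom)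
    \<comment> \<open>\<open>k\<close> is the preimage of \<open>t\<close> under \<open>q\<close>.
      It contains \<open>n\<close> and is still disjoint from \<open>m\<close>, so maximality puts
      it below \<open>n\<close>.\<close>
    obtain K k where k: "k \<in> Hom C K E" "is_kernel C k (e \<cdot> q)" "(e \<cdot> q) \<cdot> k = Zero C K R" "is_mono C k"
      using obtain_kernel[OF eq] by blast
    note kert = mono_is_kernel_of_cokernel[OF t(2,1) e(2)]
    have "(e \<cdot> q) \<cdot> n = Zero C N R"
      using Comp_assoc[OF n(2) q(1) e(1)] q(3) comp_zero[OF e(1)] HomD[OF n(2)] by simp
    then obtain l where l: "l \<in> Hom C N K" "k \<cdot> l = n"
      using kernel_factor[OF k(2) eq n(2)] HomD[OF k(1)] by metis
    have qk: "q \<cdot> k \<in> Hom C K Q" using k(1) q(1) by (rule Comp_Hom)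
    have "e \<cdot> (q \<cdot> k) = Zero C K R" using k(3) Comp_assoc[OF k(1) q(1) e(1)] by simp
    then obtain s where s: "s \<in> Hom C K T" "t \<cdot> s = q \<cdot> k"
      using kernel_factor[OF kert e(1) qk] HomD[OF t(1)] by metis
    have "disjoint_sub C m k"
    proof (rule disjoint_subI[OF m(2) k(1)])
      fix S a b assume a: "a \<in> Hom C S M" and b: "b \<in> Hom C S K" and ab: "m \<cdot> a = k \<cdot> b"
      have tsb: "t \<cdot> (s \<cdot> b) = (q \<cdot> m) \<cdot> a"
        using Comp_assoc[OF b s(1) t(1)] s(2) Comp_assoc[OF b k(1) q(1)] Comp_assoc[OF a m(2) q(1)] ab by simp
      have "t \<cdot> (s \<cdot> b) = Zero C S Q" by (rule disjoint_subD[OF dt t(1) qm Comp_Hom[OF b s(1)] a tsb])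
      then have "a = Zero C S M" using tsb by (intro mono_zero_cancel[OF qmm qm a]) simp
      then show "m \<cdot> a = Zero C S E" using comp_zero[OF m(2)] HomD[OF a] by simp
    qed
    then have "sub_le C k n" using max[OF k(4,1)] sub_leI[OF k(1) l] by blast
    then have "q \<cdot> k = Zero C K Q" using sub_le_iff_cokernel[OF n q(2) k(1)] HomD[OF q(1)] by simp
    moreover have "is_cokernel C (e \<cdot> q) k"
      by (rule epi_is_cokernel_of_kernel[OF epi_comp[OF q(4,1) e(4,1)] eq k(2)])
    ultimately obtain u where u: "u \<in> Hom C R Q" "u \<cdot> (e \<cdot> q) = q"
      using cokernel_factor[OF _ k(1) q(1)] HomD[OF eq] by metis
    have Q: "Q \<in> Obj C" using HomD[OF q(1)] by simp
    \<comment> \<open>A left inverse of \<open>e\<close> turns \<open>e \<cdot> t = 0\<close> into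
      \<open>t = 0\<close>.\<close>
    have "u \<cdot> e = Ident C Q"
      by (rule epi_cancel[OF q(4,1) Comp_Hom[OF e(1) u(1)] Ident_Hom[OF Q]])
        (use Comp_assoc[OF q(1) e(1) u(1)] u(2) Ident_Comp[OF q(1)] in simp)
    then have "t = u \<cdot> (e \<cdot> t)" using Comp_assoc[OF t(1) e(1) u(1)] Ident_Comp[OF t(1)] by simp
    then show "t = Zero C T Q" using e(3) comp_zero[OF u(1) HomD(4)[OF t(1)]] by simp
  qed
qed

text \<open>The kernel of \<open>g\<close> is disjoint from \<open>i\<close> because
  \<open>g \<cdot> i\<close> is a monomorphism, so essentiality makes it zero.\<close>

lemma essential_mono_extension_mono:
  assumes ess: "essential_mono C i" and i: "i \<in> Hom C M Q" and g: "g \<in> Hom C Q E"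
    and mono: "is_mono C (g \<cdot> i)"
  shows "is_mono C g"
proof -
  have gi: "g \<cdot> i \<in> Hom C M E" using i g by (rule Comp_Hom)
  obtain K k where k: "k \<in> Hom C K Q" "is_kernel C k g" "g \<cdot> k = Zero C K E" "is_mono C k"
    using obtain_kernel[OF g] by blast
  have "disjoint_sub C k i"
  proof (rule disjoint_subI[OF k(1) i])
    fix S a b assume a: "a \<in> Hom C S K" and b: "b \<in> Hom C S M" and eq: "k \<cdot> a = i \<cdot> b"
    have "(g \<cdot> i) \<cdot> b = Zero C S E"
      using Comp_assoc[OF b i g] eq Comp_assoc[OF a k(1) g] k(3) zero_comp[OF a] HomD[OF g] by simp
    then have "b = Zero C S M" by (rule mono_zero_cancel[OF mono gi b])
    then show "k \<cdot> a = Zero C S Q" using eq comp_zero[OF i] HomD[OF b] by simp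
  qed
  then have k0: "k = Zero C K Q" using ess k essential_mono_iff[OF i] by blast
  show ?thesis
  proof (rule mono_if_zero_cancel[OF g])
    fix S a assume a: "a \<in> Hom C S Q" and z: "g \<cdot> a = Zero C S E"
    obtain h where "h \<in> Hom C S K" "k \<cdot> h = a" using kernel_factor[OF k(2) g a z] HomD[OF k(1)] by metis
    then show "a = Zero C S Q" using k0 zero_comp HomD[OF g] by metis
  qed
qed

end

section \<open>Maximal essential extensions, maximal complements, and the envelope\<close>

context grothendieck_category
begin

lemma maximal_essential_over:
  assumes x: "is_mono C x" "x \<in> Hom C X E"
  obtains m where "essential_over C E x m" "\<And>n. essential_over C E x n \<Longrightarrow> sub_le C m n \<Longrightarrow> sub_le C n m"
proof (rule maximal_subobject[of E "essential_over C E x" x])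
  have t0: "t = Zero C T E"
    if t: "t \<in> Hom C T E" and le: "sub_le C t x" and d: "disjoint_sub C t x" for T t
  proof -
    obtain h where h: "h \<in> Hom C T X" "x \<cdot> h = t" using sub_leE[OF le t x(2)] .
    have T: "T \<in> Obj C" using HomD[OF t] by simp
    show ?thesis
      using disjoint_subD[OF d t x(2) Ident_Hom[OF T] h(1)] h(2) Comp_Ident[OF t] by simp
  qed
  show "E \<in> Obj C" using HomD[OF x(2)] by simp
  show "essential_over C E x x"
    unfolding essential_over_def using x HomD[OF x(2)] sub_le_refl[OF x(2)] t0 by simp
next
  fix I :: "'u set" and n c s
  assume small: "|I| <o \<kappa>" and dir: "directed_subobjects C E I n"
    and ess: "\<And>i. i \<in> I \<Longrightarrow> essential_over C E x (n i)"
    and jc: "joint_cokernel C I n E c" and ker: "is_kernel C s c"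
  note c = joint_cokernelD(1)[OF jc]
  note s = is_kernelD[OF ker c]
  obtain i where i: "i \<in> I" using dir unfolding directed_subobjects_def directed_on_def by blast
  have n: "n i \<in> Hom C (Dom C (n i)) E" using ess[OF i] by (simp add: essential_over_def)
  show "essential_over C E x s"
    unfolding essential_over_def
  proof (intro conjI allI impI)
    show "is_mono C s" using ker by (rule kernel_mono)
    show "s \<in> Hom C (Dom C s) E" by (rule s(1))
    have "sub_le C x (n i)" using ess[OF i] by (simp add: essential_over_def)
    then show "sub_le C x s"
      using sub_le_trans[OF _ joint_kernel_upper[OF dir jc ker i] x(2) n s(1)] by simp
    fix T t assume t: "t \<in> Hom C T E" "is_mono C t" and le: "sub_le C t s" and d: "disjoint_sub C t x"
    \<comment> \<open>\<open>t\<close> is disjoint from every \<open>n i\<close>, hence embeds into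
      the quotient by the join \<open>s\<close>. Lying below \<open>s\<close>, it is also killed by
      \<open>c\<close>, so it is zero.\<close>
    have "is_mono C (c \<cdot> t)"
      by (rule directed_join_disjoint[OF small dir jc t(2,1)])
        (rule essential_over_disjoint[OF ess x(2) t(2,1) d])
    moreover obtain h where h: "h \<in> Hom C T (Dom C s)" "s \<cdot> h = t" using sub_leE[OF le t(1) s(1)] .
    have "c \<cdot> t = Zero C T (Cod C c)"
      using Comp_assoc[OF h(1) s(1) c] h(2) s(2) zero_comp[OF h(1)] HomD[OF c] by simp
    ultimately show "t = Zero C T E" using mono_zero_comp[OF _ t(1) c] by blast
  qed
qed (auto simp: essential_over_def intro: that)

text \<open>Zorn's lemma starts at the zero subobject. Joins keep disjointness because the
  monomorphisms from \<open>M\<close> into the quotients by the \<open>n i\<close> pass to the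
  limit.\<close>

lemma maximal_complement:
  assumes m: "is_mono C m" "m \<in> Hom C M E"
  obtains N n where "is_mono C n" "n \<in> Hom C N E" "disjoint_sub C m n"
    "\<And>K k. is_mono C k \<Longrightarrow> k \<in> Hom C K E \<Longrightarrow> disjoint_sub C m k \<Longrightarrow> sub_le C n k \<Longrightarrow> sub_le C k n"
proof -
  define Pr where "Pr n \<longleftrightarrow> is_mono C n \<and> n \<in> Hom C (Dom C n) E \<and> disjoint_sub C m n" for n
  have E: "E \<in> Obj C" using HomD[OF m(2)] by simp
  obtain Z where Z: "zero_object C Z" using ex_zero_object by blast
  have Zo: "Z \<in> Obj C" using Z by (simp add: zero_object_def)
  let ?z = "Zero C Z E"
  have z: "?z \<in> Hom C Z E" using Zo E by (rule zero_Hom)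
  have z_mono: "is_mono C ?z"
    by (rule mono_if_zero_cancel[OF z]) (rule zero_object_HomD(2)[OF Z])
  have "disjoint_sub C m ?z" using disjoint_sub_sym[OF disjoint_zero_sub[OF m(2) Zo] z m(2)] .
  then have z_Pr: "Pr ?z" using z z_mono HomD[OF z] by (simp add: Pr_def)
  have Pr_join: "Pr s" if small: "|I| <o \<kappa>" and dir: "directed_subobjects C E I n"
    and n: "\<And>i. i \<in> I \<Longrightarrow> Pr (n i)" and jc: "joint_cokernel C I n E c" and ker: "is_kernel C s c"
    for I :: "'u set" and n c s
  proof -
    note c = joint_cokernelD(1)[OF jc]
    note s = is_kernelD[OF ker c]
    have cm: "c \<cdot> m \<in> Hom C M (Cod C c)" using m(2) c by (rule Comp_Hom)
    have mono: "is_mono C (c \<cdot> m)"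
      by (rule directed_join_disjoint[OF small dir jc m]) (use n in \<open>simp add: Pr_def\<close>)
    have "disjoint_sub C m s"
    proof (rule disjoint_subI[OF m(2) s(1)])
      fix T a b assume a: "a \<in> Hom C T M" and b: "b \<in> Hom C T (Dom C s)" and eq: "m \<cdot> a = s \<cdot> b"
      have "(c \<cdot> m) \<cdot> a = Zero C T (Cod C c)"
        using Comp_assoc[OF a m(2) c] eq Comp_assoc[OF b s(1) c] s(2) zero_comp[OF b] HomD[OF c] by simp
      then have "a = Zero C T M" by (rule mono_zero_cancel[OF mono cm a])
      then show "m \<cdot> a = Zero C T E" using comp_zero[OF m(2)] HomD[OF a] by simp
    qed
    then show ?thesis using s(1) kernel_mono[OF ker] by (simp add: Pr_def)
  qed
  obtain n where "Pr n" "\<And>k. Pr k \<Longrightarrow> sub_le C n k \<Longrightarrow> sub_le C k n"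
    by (rule maximal_subobject[of E Pr ?z, OF E z_Pr _ Pr_join]) (auto simp: Pr_def)
  then show ?thesis using that[of n "Dom C n"] HomD(2) unfolding Pr_def by metis
qed

lemma injective_envelope_within:
  assumes E: "injective_object C E" and x: "is_mono C x" "x \<in> Hom C X E"
  obtains M m y where "m \<in> Hom C M E" "is_mono C m" "y \<in> Hom C X M" "m \<cdot> y = x"
    "injective_envelope C X M y"
proof -
  obtain m where ess: "essential_over C E x m"
    and max: "\<And>n. essential_over C E x n \<Longrightarrow> sub_le C m n \<Longrightarrow> sub_le C n m"
    using maximal_essential_over[OF x] by blast
  define M where "M = Dom C m"
  have m: "is_mono C m" "m \<in> Hom C M E" using ess unfolding essential_over_def M_def by auto
  obtain y where y: "y \<in> Hom C X M" "m \<cdot> y = x"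
    using sub_leE[OF _ x(2) m(2)] ess unfolding essential_over_def by blast
  obtain N n where n: "is_mono C n" "n \<in> Hom C N E" "disjoint_sub C m n"
    and nmax: "\<And>K k. is_mono C k \<Longrightarrow> k \<in> Hom C K E \<Longrightarrow> disjoint_sub C m k \<Longrightarrow> sub_le C n k \<Longrightarrow> sub_le C k n"
    by (rule maximal_complement[OF m, where thesis = thesis]) (rule that)
  obtain Q q where q: "q \<in> Hom C E Q" "is_cokernel C q n" "q \<cdot> n = Zero C N Q" "is_epi C q"
    using obtain_cokernel[OF n(2)] by blast
  have qm: "q \<cdot> m \<in> Hom C M Q" using m(2) q(1) by (rule Comp_Hom)
  have essq: "essential_mono C (q \<cdot> m)" by (rule quotient_by_maximal_complement[OF m n nmax q])
  then have qmm: "is_mono C (q \<cdot> m)" by (simp add: essential_mono_def)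
  \<comment> \<open>Injectivity of \<open>E\<close> maps \<open>Q\<close> back to \<open>E\<close>
    over \<open>M\<close>. The result is a subobject of \<open>E\<close> containing
    \<open>m\<close>, so it can be compared with the maximal \<open>m\<close>.\<close>
  obtain g where g: "g \<in> Hom C Q E" "g \<cdot> (q \<cdot> m) = m" using injective_extension[OF E qmm qm m(2)] .
  have gm: "is_mono C g" by (rule essential_mono_extension_mono[OF essq qm g(1)]) (simp add: g(2) m(1))
  have mg: "sub_le C m g" by (rule sub_leI[OF g(1) qm g(2)])
  have "essential_over C E x g"
    unfolding essential_over_def
  proof (intro conjI allI impI)
    show "g \<in> Hom C (Dom C g) E" using g(1) HomD[OF g(1)] by simp
    show "sub_le C x g" using sub_le_trans[OF _ mg x(2) m(2) g(1)] ess by (simp add: essential_over_def)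
    fix T t assume t: "t \<in> Hom C T E" "is_mono C t" and le: "sub_le C t g" and d: "disjoint_sub C t x"
    \<comment> \<open>A subobject disjoint from \<open>x\<close> is disjoint from \<open>m\<close>,
      so the subobject \<open>h\<close> of \<open>Q\<close> behind it is disjoint from
      \<open>q \<cdot> m\<close> and vanishes.\<close>
    note dm = essential_over_disjoint[OF ess x(2) t(2,1) d]
    obtain h where h: "h \<in> Hom C T Q" "g \<cdot> h = t" using sub_leE[OF le t(1) g(1)] .
    have "is_mono C h" by (rule mono_right_factor[OF _ h(1) g(1)]) (simp add: h(2) t(2))
    moreover have "disjoint_sub C h (q \<cdot> m)"
    proof (rule disjoint_subI[OF h(1) qm])
      fix S a b assume a: "a \<in> Hom C S T" and b: "b \<in> Hom C S M" and eq: "h \<cdot> a = (q \<cdot> m) \<cdot> b"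
      have "t \<cdot> a = m \<cdot> b" using Comp_assoc[OF a h(1) g(1)] Comp_assoc[OF b qm g(1)] eq h(2) g(2) by simp
      then have "t \<cdot> a = Zero C S E" by (rule disjoint_subD[OF dm t(1) m(2) a b])
      then have "a = Zero C S T" by (rule mono_zero_cancel[OF t(2,1) a])
      then show "h \<cdot> a = Zero C S Q" using comp_zero[OF h(1)] HomD[OF a] by simp
    qed
    ultimately have "h = Zero C T Q" using essq h(1) essential_mono_iff[OF qm] by blast
    then show "t = Zero C T E" using h(2) comp_zero[OF g(1)] HomD[OF t(1)] by simp
  qed (rule gm)
  then have "sub_le C g m" using mg by (rule max)
  then obtain l where l: "l \<in> Hom C Q M" "m \<cdot> l = g" using sub_leE[OF _ g(1) m(2)] by blast
  have M: "M \<in> Obj C" using HomD[OF m(2)] by simp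
  \<comment> \<open>\<open>l \<cdot> q\<close> is a retraction of \<open>E\<close> onto
    \<open>M\<close>, since \<open>m \<cdot> l = g\<close> and
    \<open>g \<cdot> (q \<cdot> m) = m\<close>.\<close>
  have lq: "l \<cdot> q \<in> Hom C E M" using q(1) l(1) by (rule Comp_Hom)
  have "m \<cdot> (l \<cdot> q \<cdot> m) = m \<cdot> Ident C M"
    using Comp_assoc[OF m(2) q(1) l(1)] Comp_assoc[OF qm l(1) m(2)] l(2) g(2) Comp_Ident[OF m(2)] by simp
  then have "l \<cdot> q \<cdot> m = Ident C M"
    by (rule mono_cancel[OF m Comp_Hom[OF m(2) lq] Ident_Hom[OF M]])
  then have "injective_object C M" by (rule injective_retract[OF E m(2) lq])
  moreover have "essential_mono C y" by (rule essential_mono_if_essential_over[OF ess m(2) y(1) x(1) y(2)])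
  ultimately show ?thesis using that[OF m(2,1) y] y(1) unfolding injective_envelope_def by blast
qed

end

section \<open>Left exact preradicals\<close>

context abelian_category
begin

lemma preradicalD:
  assumes "is_preradical C \<gamma>"
  shows "X \<in> Obj C \<Longrightarrow> OMap \<gamma> X \<in> Obj C"
    and "X \<in> Obj C \<Longrightarrow> Incl \<gamma> X \<in> Hom C (OMap \<gamma> X) X"
    and "X \<in> Obj C \<Longrightarrow> is_mono C (Incl \<gamma> X)"
    and "f \<in> Hom C X Y \<Longrightarrow> AMap \<gamma> f \<in> Hom C (OMap \<gamma> X) (OMap \<gamma> Y)"
    and "f \<in> Hom C X Y \<Longrightarrow> Incl \<gamma> Y \<cdot> AMap \<gamma> f = f \<cdot> Incl \<gamma> X"
  using assms unfolding is_preradical_def is_functor_def Hom_def by auto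

lemma iso_if_mono_section:
  assumes m: "is_mono C m" "m \<in> Hom C X Y" and s: "s \<in> Hom C Y X" "m \<cdot> s = Ident C Y"
  shows "is_iso C m" "s \<cdot> m = Ident C X"
proof -
  have X: "X \<in> Obj C" using HomD[OF m(2)] by simp
  have "m \<cdot> (s \<cdot> m) = m \<cdot> Ident C X"
    using Comp_assoc[OF m(2) s(1) m(2)] s(2) Ident_Comp[OF m(2)] Comp_Ident[OF m(2)] by simp
  then show sm: "s \<cdot> m = Ident C X"
    by (rule mono_cancel[OF m Comp_Hom[OF m(2) s(1)] Ident_Hom[OF X]])
  show "is_iso C m" using sm s HomD[OF m(2)] unfolding is_iso_def by auto
qed

text \<open>The inverse \<open>s\<close> of \<open>Incl \<gamma> T\<close> and naturality let
  \<open>f\<close> pass through \<open>AMap \<gamma> f\<close>. So \<open>Incl \<gamma> E\<close>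
  contains the image of every pretorsion object.\<close>

lemma pretorsion_factor:
  assumes \<gamma>: "is_preradical C \<gamma>" and T: "T \<in> pretorsion_class C \<gamma>" and f: "f \<in> Hom C T E"
  obtains h where "h \<in> Hom C T (OMap \<gamma> E)" "Incl \<gamma> E \<cdot> h = f"
proof -
  note \<gamma>D = preradicalD[OF \<gamma>]
  have To: "T \<in> Obj C" and iso: "is_iso C (Incl \<gamma> T)" using T by (auto simp: pretorsion_class_def)
  obtain s where s: "s \<in> Hom C T (OMap \<gamma> T)" "Incl \<gamma> T \<cdot> s = Ident C T"
    using iso HomD[OF \<gamma>D(2)[OF To]] unfolding is_iso_def by auto
  have E: "E \<in> Obj C" using HomD[OF f] by simp
  show ?thesis
  proof (rule that[OF Comp_Hom[OF s(1) \<gamma>D(4)[OF f]]])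
    show "Incl \<gamma> E \<cdot> (AMap \<gamma> f \<cdot> s) = f"
      using Comp_assoc[OF s(1) \<gamma>D(4)[OF f] \<gamma>D(2)[OF E]] \<gamma>D(5)[OF f]
        Comp_assoc[OF s(1) \<gamma>D(2)[OF To] f] s(2) Comp_Ident[OF f] by simp
  qed
qed

text \<open>With \<open>c\<close> the cokernel of \<open>Incl \<gamma> X\<close>, naturality gives
  \<open>AMap \<gamma> c = 0\<close>. By left exactness
  \<open>AMap \<gamma> (Incl \<gamma> X)\<close> is a kernel of this zero arrow, hence split, and by
  naturality it equals the inclusion of \<open>\<gamma>(\<gamma>(X))\<close>.\<close>

lemma left_exact_preradical_idempotent:
  assumes \<gamma>: "is_preradical C \<gamma>" and le: "left_exact C C \<gamma>" and X: "X \<in> Obj C"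
  shows "OMap \<gamma> X \<in> pretorsion_class C \<gamma>"
proof -
  note \<gamma>D = preradicalD[OF \<gamma>]
  let ?x = "Incl \<gamma> X" and ?A = "OMap \<gamma> X"
  have A: "?A \<in> Obj C" using \<gamma>D(1)[OF X] .
  note x = \<gamma>D(3)[OF X] \<gamma>D(2)[OF X]
  obtain Q c where c: "c \<in> Hom C X Q" "is_cokernel C c ?x" "c \<cdot> ?x = Zero C ?A Q" "is_epi C c"
    using obtain_cokernel[OF x(2)] by blast
  have Q: "Q \<in> Obj C" using HomD[OF c(1)] by simp
  have ker: "is_kernel C (AMap \<gamma> ?x) (AMap \<gamma> c)"
    using le mono_is_kernel_of_cokernel[OF x c(2)] unfolding left_exact_def by blast
  have gc: "AMap \<gamma> c = Zero C ?A (OMap \<gamma> Q)"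
    by (rule mono_zero_cancel[OF \<gamma>D(3)[OF Q] \<gamma>D(2)[OF Q] \<gamma>D(4)[OF c(1)]]) (simp add: \<gamma>D(5)[OF c(1)] c(3))
  have "AMap \<gamma> ?x = Incl \<gamma> ?A"
    by (rule mono_cancel[OF x \<gamma>D(4)[OF x(2)] \<gamma>D(2)[OF A] \<gamma>D(5)[OF x(2)]])
  moreover obtain s where "s \<in> Hom C ?A (Dom C (AMap \<gamma> ?x))" "AMap \<gamma> ?x \<cdot> s = Ident C ?A"
  proof (rule kernel_factor[OF ker \<gamma>D(4)[OF c(1)] Ident_Hom[OF A]])
    show "AMap \<gamma> c \<cdot> Ident C ?A = Zero C ?A (OMap \<gamma> Q)" using gc Comp_Ident[OF \<gamma>D(4)[OF c(1)]] by simp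
  qed
  ultimately have "is_iso C (Incl \<gamma> ?A)"
    using iso_if_mono_section(1)[OF \<gamma>D(3)[OF A] \<gamma>D(2)[OF A]] HomD[OF \<gamma>D(2)[OF A]] by simp
  then show ?thesis using A by (simp add: pretorsion_class_def)
qed

text \<open>The retraction \<open>r\<close> of \<open>E\<close> onto \<open>\<gamma>(E)\<close>
  restricts along \<open>e\<close> to the monomorphism \<open>y\<close>, so by essentiality
  \<open>r\<close> is a monomorphism: the complement of \<open>\<gamma>(E)\<close> vanishes. Then
  \<open>r\<close> and its section are isomorphisms.\<close>

lemma stable_if_preserves_injectives:
  assumes \<gamma>: "is_preradical C \<gamma>" and pres: "preserves_injectives C C \<gamma>"
  shows "is_stable C (pretorsion_class C \<gamma>)"
  unfolding is_stable_def
proof (intro ballI allI impI)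
  fix X E e assume X: "X \<in> pretorsion_class C \<gamma>" and env: "injective_envelope C X E e"
  note \<gamma>D = preradicalD[OF \<gamma>]
  have e: "e \<in> Hom C X E" and ess: "essential_mono C e" and E: "injective_object C E"
    using env by (auto simp: injective_envelope_def)
  have Eo: "E \<in> Obj C" using HomD[OF e] by simp
  let ?a = "Incl \<gamma> E" and ?A = "OMap \<gamma> E"
  note a = \<gamma>D(3)[OF Eo] \<gamma>D(2)[OF Eo]
  have A: "?A \<in> Obj C" using \<gamma>D(1)[OF Eo] .
  have "injective_object C ?A" using pres E by (simp add: preserves_injectives_def)
  then obtain r where r: "r \<in> Hom C E ?A" "r \<cdot> ?a = Ident C ?A"
    using injective_extension[OF _ a Ident_Hom[OF A]] by blast
  obtain y where y: "y \<in> Hom C X ?A" "?a \<cdot> y = e" using pretorsion_factor[OF \<gamma> X e] .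
  have "r \<cdot> e = y" using Comp_assoc[OF y(1) a(2) r(1)] r(2) y(2) Ident_Comp[OF y(1)] by simp
  moreover have "is_mono C y"
    by (rule mono_right_factor[OF _ y(1) a(2)]) (use ess y(2) in \<open>simp add: essential_mono_def\<close>)
  ultimately have rm: "is_mono C r" using essential_mono_extension_mono[OF ess e r(1)] by simp
  have "is_iso C ?a"
    using iso_if_mono_section(2)[OF rm r(1) a(2) r(2)] iso_if_mono_section(1)[OF a r(1)] by simp
  then show "E \<in> pretorsion_class C \<gamma>" using Eo by (simp add: pretorsion_class_def)
qed

end

text \<open>Stability puts the envelope \<open>M\<close> into the pretorsion class, so its inclusion
  factors through \<open>\<gamma>(E)\<close>. This makes \<open>\<gamma>(E)\<close> a retract of the
  injective object \<open>M\<close>.\<close>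

lemma (in grothendieck_category) preserves_injectives_if_stable:
  assumes \<gamma>: "is_preradical C \<gamma>" and le: "left_exact C C \<gamma>" and st: "is_stable C (pretorsion_class C \<gamma>)"
  shows "preserves_injectives C C \<gamma>"
  unfolding preserves_injectives_def
proof (intro allI impI)
  fix E assume E: "injective_object C E"
  then have Eo: "E \<in> Obj C" by (simp add: injective_object_def)
  note \<gamma>D = preradicalD[OF \<gamma>]
  let ?x = "Incl \<gamma> E" and ?X = "OMap \<gamma> E"
  note x = \<gamma>D(3)[OF Eo] \<gamma>D(2)[OF Eo]
  obtain M m y where m: "m \<in> Hom C M E" "is_mono C m" and y: "y \<in> Hom C ?X M" "m \<cdot> y = ?x"
    and env: "injective_envelope C ?X M y"
    using injective_envelope_within[OF E x] by blast
  have M: "M \<in> pretorsion_class C \<gamma>"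
    using st env left_exact_preradical_idempotent[OF \<gamma> le Eo] unfolding is_stable_def by blast
  obtain z where z: "z \<in> Hom C M ?X" "?x \<cdot> z = m" using pretorsion_factor[OF \<gamma> M m(1)] .
  have "?x \<cdot> (z \<cdot> y) = ?x \<cdot> Ident C ?X"
    using Comp_assoc[OF y(1) z(1) x(2)] z(2) y(2) Comp_Ident[OF x(2)] by simp
  then have "z \<cdot> y = Ident C ?X"
    by (rule mono_cancel[OF x Comp_Hom[OF y(1) z(1)] Ident_Hom[OF \<gamma>D(1)[OF Eo]]])
  moreover have "injective_object C M" using env by (simp add: injective_envelope_def)
  ultimately show "injective_object C ?X" using injective_retract[OF _ y(1) z(1)] by blast
qed

theorem proposition3p4:
  fixes \<kappa> :: "'u rel"
    and C :: "('o, 'm) abcat"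
    and \<gamma> :: "('o, 'm) preradical"
  assumes "locally_noetherian_grothendieck_category \<kappa> C"
    and "is_preradical C \<gamma>"
    and "left_exact C C \<gamma>"
  shows "preserves_injectives C C \<gamma> \<longleftrightarrow> is_stable C (pretorsion_class C \<gamma>)"
proof -
  interpret locally_noetherian_grothendieck_category \<kappa> C by fact
  show ?thesis
    using stable_if_preserves_injectives preserves_injectives_if_stable assms(2,3) by blast
qed

end
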